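(* Let $P$ be a probability measure on $\Omega_{\mathbb Z}$ such that, for some positive integers $L,R$: (i) the transition vectors $\{\omega^x\}_{x\in\mathbb Z}$ are i.i.d. under $P$; (ii) for $P$-a.e. environment $\omega$, the Markov chain induced by $P_\omega^0$ is irreducible on $\mathbb Z$; (iii) for $P$-a.e. $\omega$, $\omega(a,b)=0$ whenever $b\notin[a-L,a+R]$; (iv) for $P$-a.e. $\omega$, $\lim_{n\to\infty}X_n=\infty$, $P_\omega^0$-a.s. Then $v>0$ if and only if $\mathbb E^0[H_{\ge 1}]<\infty$.
   Context: An environment on $\mathbb Z$ is a function $\omega:\mathbb Z\times\mathbb Z\to[0,1]$ with $\sum_y\omega(x,y)=1$ for all $x$; $\Omega_{\mathbb Z}$ is the space of environments (a product of spaces of probability measures on $\mathbb Z$, with its Borel sigma-field). For $x\in\mathbb Z$, $\omega^x$ is the probability measure $y\mapsto\omega(x,x+y)$ on $\mathbb Z$. $P_\omega^x$ is the law of the Markov chain $(X_n)_{n\ge0}$ with $X_0=x$ and transition probabilities $\omega$. The annealed law is $\mathbb P^x(\cdot)=E[P_\omega^x(\cdot)]$, with $E$ expectation under $P$, and $\mathbb E^x$ is the corresponding expectation. Under (i)-(iv) there is a deterministic $v$ with $\lim_{n\to\infty}X_n/n=v$, $\mathbb P^0$-a.s.; $v$ denotes this limiting velocity. $H_{\ge 1}=\inf\{n\ge0: X_n\ge 1\}$ is the first time the walk hits the set of integers $\geq 1$. *)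

theory Defs
  imports "HOL-Probability.Probability"
begin

text \<open>
  An environment \<open>\<omega>\<close> assigns to every site \<open>x\<close> the probability measure \<open>\<omega>(x, \<cdot>)\<close> on the integers.
  The sigma-algebra of \<^const>\<open>prob_algebra\<close> is generated by the evaluations \<open>\<mu> \<mapsto> \<mu>(A)\<close>; over a
  countable discrete space this is the Borel sigma-algebra of the weak topology, and the Borel
  sigma-algebra of the countable product of these Polish spaces is the product sigma-algebra.
\<close>

definition env_space :: "(int \<Rightarrow> int measure) measure" where
  "env_space = PiM UNIV (\<lambda>_. prob_algebra (count_space UNIV))"

definition trans_prob :: "(int \<Rightarrow> int measure) \<Rightarrow> int \<Rightarrow> int \<Rightarrow> real" where
  "trans_prob \<omega> a b = measure (\<omega> a) {b}"

text \<open>The measure \<open>\<omega>\<^sup>x\<close>, that is \<open>y \<mapsto> \<omega>(x, x + y)\<close>.\<close>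

definition trans_vec :: "(int \<Rightarrow> int measure) \<Rightarrow> int \<Rightarrow> int measure" where
  "trans_vec \<omega> x = distr (\<omega> x) (count_space UNIV) (\<lambda>z. z - x)"

definition path_space :: "(nat \<Rightarrow> int) measure" where
  "path_space = PiM UNIV (\<lambda>_. count_space UNIV)"

text \<open>
  The law of the Markov chain started at \<open>x\<close> is the Ionescu-Tulcea limit of the kernels below:
  the kernel at time \<open>0\<close> is the point mass at \<open>x\<close>, and the kernel at time \<open>n + 1\<close> is the transition
  probability at the position at time \<open>n\<close>. The right-hand side of \<open>quenched\<close> is what \<open>PF.lim\<close>
  abbreviates inside the locale \<^locale>\<open>Ionescu_Tulcea\<close>; the usual formula for the
  finite-dimensional distributions is lemma \<open>measure_quenched_cylinder\<close> below.
\<close>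

definition walk_kernel :: "(int \<Rightarrow> int measure) \<Rightarrow> int \<Rightarrow> nat \<Rightarrow> (nat \<Rightarrow> int) \<Rightarrow> int measure" where
  "walk_kernel \<omega> x n X = (case n of 0 \<Rightarrow> return (count_space UNIV) x | Suc m \<Rightarrow> \<omega> (X m))"

definition quenched :: "(int \<Rightarrow> int measure) \<Rightarrow> int \<Rightarrow> (nat \<Rightarrow> int) measure" where
  "quenched \<omega> x =
     projective_family.lim UNIV (Ionescu_Tulcea.CI (walk_kernel \<omega> x) (\<lambda>_. count_space UNIV))
       (\<lambda>_. count_space UNIV)"

text \<open>
  The annealed law. The kernel is measurable (lemma \<open>measurable_quenched\<close>), so that
  \<^const>\<open>bind\<close> is the mixture of the quenched laws (lemma \<open>emeasure_annealed\<close>).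
\<close>

definition annealed :: "(int \<Rightarrow> int measure) measure \<Rightarrow> int \<Rightarrow> (nat \<Rightarrow> int) measure" where
  "annealed P x = P \<bind> (\<lambda>\<omega>. quenched \<omega> x)"

definition irreducible_walk :: "(int \<Rightarrow> int measure) \<Rightarrow> bool" where
  "irreducible_walk \<omega> \<longleftrightarrow> (\<forall>x y. \<exists>n. measure (quenched \<omega> x) {X. X n = y} > 0)"

text \<open>Here \<^term>\<open>Inf {} = (\<infinity> :: enat)\<close>, so a path that never reaches \<open>[k, \<infinity>)\<close> has hitting time \<open>\<infinity>\<close>.\<close>

definition hit_ge :: "int \<Rightarrow> (nat \<Rightarrow> int) \<Rightarrow> enat" where
  "hit_ge k X = Inf (enat ` {n. X n \<ge> k})"

lemma env_spaceD:
  assumes "\<omega> \<in> space env_space"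
  shows "prob_space (\<omega> a)" "sets (\<omega> a) = UNIV" "space (\<omega> a) = UNIV"
proof -
  have "\<omega> a \<in> space (prob_algebra (count_space UNIV))"
    using assms by (auto simp: env_space_def space_PiM)
  then show "prob_space (\<omega> a)" and s: "sets (\<omega> a) = UNIV"
    by (auto simp: space_prob_algebra)
  show "space (\<omega> a) = UNIV"
    using sets_eq_imp_space_eq[of "\<omega> a" "count_space UNIV"] s by simp
qed

lemma Ionescu_Tulcea_walk:
  assumes "\<omega> \<in> space env_space"
  shows "Ionescu_Tulcea (walk_kernel \<omega> x) (\<lambda>_. count_space UNIV)"
proof (rule Ionescu_Tulcea.intro)
  show "walk_kernel \<omega> x i
          \<in> measurable (PiM {0..<i} (\<lambda>_. count_space UNIV)) (subprob_algebra (count_space UNIV))" for i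
  proof (cases i)
    case 0
    have "return (count_space UNIV) x \<in> space (subprob_algebra (count_space UNIV))"
      by (simp add: space_subprob_algebra prob_space_return prob_space_imp_subprob_space)
    then show ?thesis
      unfolding 0 walk_kernel_def by simp
  next
    case (Suc m)
    have "\<omega> \<in> measurable (count_space UNIV) (subprob_algebra (count_space UNIV))"
      using env_spaceD[OF assms]
      by (auto simp: space_subprob_algebra intro: prob_space_imp_subprob_space)
    moreover have "(\<lambda>X. X m) \<in> measurable (PiM {0..<i} (\<lambda>_. count_space UNIV)) (count_space (UNIV :: int set))"
      by (rule measurable_component_singleton) (simp add: Suc)
    ultimately show ?thesis
      unfolding walk_kernel_def Suc nat.case by (rule measurable_compose[rotated])
  qed
  show "prob_space (walk_kernel \<omega> x i X)" for i X
    using env_spaceD[OF assms]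
    by (cases i) (auto simp: walk_kernel_def prob_space_return)
qed

lemma sets_quenched:
  assumes "\<omega> \<in> space env_space"
  shows "sets (quenched \<omega> x) = sets path_space"
proof -
  interpret Ionescu_Tulcea "walk_kernel \<omega> x" "\<lambda>_. count_space UNIV"
    by (rule Ionescu_Tulcea_walk[OF assms])
  show ?thesis
    by (simp add: quenched_def path_space_def)
qed

lemma prob_space_quenched:
  assumes "\<omega> \<in> space env_space"
  shows "prob_space (quenched \<omega> x)"
proof -
  interpret Ionescu_Tulcea "walk_kernel \<omega> x" "\<lambda>_. count_space UNIV"
    by (rule Ionescu_Tulcea_walk[OF assms])
  have sp: "space PF.lim = UNIV"
    using sets_eq_imp_space_eq[OF PF.sets_lim] by (simp add: space_PiM)
  have *: "PF.emb UNIV {} {\<lambda>_. undefined} = UNIV"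
    by (auto simp: prod_emb_def space_PiM)
  have "emeasure PF.lim (PF.emb UNIV {} {\<lambda>_. undefined}) = emeasure (CI {}) {\<lambda>_. undefined}"
    by (rule lim) (auto simp: PiM_empty)
  also have "\<dots> = emeasure (CI {}) (space (CI {}))"
    by (simp add: CI_def space_PiM)
  also have "\<dots> = 1"
    by (intro prob_space.emeasure_space_1 PF.prob_space_P) auto
  finally show ?thesis
    unfolding quenched_def by (intro prob_spaceI) (simp only: sp *)
qed

lemma cylinder_sets: "{X. \<forall>i\<le>n. X i = p i} \<in> sets path_space"
proof -
  have "{X. \<forall>i\<le>n. X i = p i} = (\<Pi>\<^sub>E i\<in>UNIV. if i \<le> n then {p i} else UNIV)"
    by (auto simp: PiE_def Pi_def split: if_splits)
  also have "\<dots> \<in> sets path_space"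
    unfolding path_space_def by (intro sets_PiM_I_countable) auto
  finally show ?thesis .
qed

lemma emeasure_quenched_cylinder:
  assumes \<omega>: "\<omega> \<in> space env_space"
  shows "emeasure (quenched \<omega> x) {X. \<forall>i\<le>n. X i = p i} =
    indicator {x} (p 0) * (\<Prod>i<n. emeasure (\<omega> (p i)) {p (Suc i)})"
proof -
  interpret Ionescu_Tulcea "walk_kernel \<omega> x" "\<lambda>_. count_space UNIV"
    by (rule Ionescu_Tulcea_walk[OF \<omega>])
  let ?M = "\<lambda>_::nat. count_space (UNIV :: int set)"
  let ?p = "\<lambda>n. restrict p {0..<n}"
  have sing: "{?p n} \<in> sets (PiM {0..<n} ?M)" for n
  proof -
    have "{?p n} = (\<Pi>\<^sub>E i\<in>{0..<n}. {?p n i})"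
      by (rule PiE_singleton[symmetric]) simp
    also have "\<dots> = (\<Pi>\<^sub>E i\<in>{0..<n}. {p i})"
      by (rule PiE_cong) simp
    also have "\<dots> \<in> sets (PiM {0..<n} ?M)" by (intro sets_PiM_I_finite) auto
    finally show ?thesis .
  qed
  have step: "emeasure (C 0 (Suc n) (\<lambda>_. undefined)) {?p (Suc n)} =
      emeasure (walk_kernel \<omega> x n (?p n)) {p n} * emeasure (C 0 n (\<lambda>_. undefined)) {?p n}" for n
  proof -
    have 0: "(\<lambda>_. undefined) \<in> space (PiM {0..<0} ?M)" by simp
    have "emeasure (C 0 (Suc n) (\<lambda>_. undefined)) {?p (Suc n)} =
        emeasure (C 0 n (\<lambda>_. undefined) \<bind> eP n) {?p (Suc n)}"
      by (simp del: fun_upd_apply)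
    also have "\<dots> = (\<integral>\<^sup>+X. emeasure (eP n X) {?p (Suc n)} \<partial>C 0 n (\<lambda>_. undefined))"
    proof (rule emeasure_bind)
      show "space (C 0 n (\<lambda>_. undefined)) \<noteq> {}"
        using prob_space.not_empty[OF prob_space_C[OF 0]] .
      show "eP n \<in> measurable (C 0 n (\<lambda>_. undefined)) (subprob_algebra (PiM {0..<Suc n} ?M))"
        using measurable_eP[of n] by (simp only: measurable_cong_sets[OF sets_C[OF 0, of n] refl] add_0)
    qed (rule sing)
    also have "\<dots> = (\<integral>\<^sup>+X. emeasure (walk_kernel \<omega> x n (?p n)) {p n} * indicator {?p n} X
        \<partial>C 0 n (\<lambda>_. undefined))"
    proof (rule nn_integral_cong)
      fix X assume "X \<in> space (C 0 n (\<lambda>_. undefined))"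
      then have X: "X \<in> space (PiM {0..<n} ?M)" by (simp add: space_C)
      have ext: "X i = undefined" if "\<not> i < n" for i
        using X that by (auto simp: space_PiM PiE_def extensional_def)
      have upd: "X(n := z) = ?p (Suc n) \<longleftrightarrow> z = p n \<and> X = ?p n" for z
      proof
        assume *: "X(n := z) = ?p (Suc n)"
        have "X i = ?p n i" for i
          using fun_cong[OF *, of i] ext[of i] by (cases "i < n") auto
        with fun_cong[OF *, of n] show "z = p n \<and> X = ?p n" by auto
      qed (auto simp: restrict_def less_Suc_eq)
      have "emeasure (eP n X) {?p (Suc n)} =
          emeasure (walk_kernel \<omega> x n X) {z. X(n := z) = ?p (Suc n)}"
        using sing[of "Suc n"] X
        by (subst emeasure_eP) (auto intro!: arg_cong[where f="emeasure _"] simp: space_P)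
      also have "\<dots> = emeasure (walk_kernel \<omega> x n (?p n)) {p n} * indicator {?p n} X"
        unfolding upd by (cases "X = ?p n") simp_all
      finally show "emeasure (eP n X) {?p (Suc n)} =
          emeasure (walk_kernel \<omega> x n (?p n)) {p n} * indicator {?p n} X" .
    qed
    also have "\<dots> = emeasure (walk_kernel \<omega> x n (?p n)) {p n} * emeasure (C 0 n (\<lambda>_. undefined)) {?p n}"
      using sing[of n] by (subst nn_integral_cmult_indicator) (auto simp: sets_C[OF 0])
    finally show ?thesis .
  qed
  have C: "emeasure (C 0 (Suc n) (\<lambda>_. undefined)) {?p (Suc n)} =
      indicator {x} (p 0) * (\<Prod>i<n. emeasure (\<omega> (p i)) {p (Suc i)})" for n
  proof (induction n)
    case 0
    have "emeasure (C 0 0 (\<lambda>_. undefined)) {?p 0} = 1"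
      using sing[of 0] by (simp add: restrict_def emeasure_return del: sets_PiM)
    then show ?case
      by (subst step) (simp add: walk_kernel_def indicator_def)
  next
    case (Suc n)
    have "walk_kernel \<omega> x (Suc n) (?p (Suc n)) = \<omega> (p n)"
      by (simp add: walk_kernel_def)
    then show ?case
      by (simp only: step[of "Suc n"] Suc.IH prod.lessThan_Suc mult_ac)
  qed
  have "{X. \<forall>i\<le>n. X i = p i} = PF.emb UNIV {0..<Suc n} {?p (Suc n)}"
    by (auto simp: prod_emb_def space_PiM fun_eq_iff restrict_def less_Suc_eq_le split: if_splits)
  then have "emeasure (quenched \<omega> x) {X. \<forall>i\<le>n. X i = p i} = emeasure (CI {0..<Suc n}) {?p (Suc n)}"
    unfolding quenched_def using lim[OF _ sing[of "Suc n"]] by simp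
  also have "\<dots> = emeasure (C 0 (Suc n) (\<lambda>_. undefined)) (PF.emb {0..<Suc n} {0..<Suc n} {?p (Suc n)})"
    using sing[of "Suc n"] by (intro emeasure_CI) auto
  also have "PF.emb {0..<Suc n} {0..<Suc n} {?p (Suc n)} = {?p (Suc n)}"
    using sing[of "Suc n"] by (intro prod_emb_id) (auto simp: space_PiM)
  finally show ?thesis using C by simp
qed

lemma measure_quenched_cylinder:
  assumes "\<omega> \<in> space env_space"
  shows "measure (quenched \<omega> x) {X. \<forall>i\<le>n. X i = p i} =
    (if p 0 = x then \<Prod>i<n. trans_prob \<omega> (p i) (p (Suc i)) else 0)"
proof -
  have fm: "emeasure (\<omega> a) A = ennreal (measure (\<omega> a) A)" for a A
    using env_spaceD(1)[OF assms, of a]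
    by (simp add: finite_measure.emeasure_eq_measure prob_space.finite_measure)
  show ?thesis
    unfolding measure_def[of "quenched _ _"] emeasure_quenched_cylinder[OF assms]
    by (simp add: fm trans_prob_def prod_ennreal prod_nonneg)
qed

lemma sets_path_space_cylinders:
  "sets path_space = sigma_sets UNIV (insert {} {{X. \<forall>i\<le>n. X i = p i} | n p. True})"
    (is "_ = sigma_sets UNIV ?G")
proof (rule antisym)
  interpret S: sigma_algebra UNIV "sigma_sets UNIV ?G"
    by (rule sigma_algebra_sigma_sets) simp
  have coord: "{X. X i \<in> A} \<in> sigma_sets UNIV ?G" for i :: nat and A :: "int set"
  proof -
    let ?L = "{l :: int list. length l = Suc i \<and> l ! i \<in> A}"
    have "{X. X i \<in> A} = (\<Union>l\<in>?L. {X. \<forall>j\<le>i. X j = l ! j})"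
    proof (intro set_eqI iffI)
      fix X :: "nat \<Rightarrow> int" assume "X \<in> {X. X i \<in> A}"
      then show "X \<in> (\<Union>l\<in>?L. {X. \<forall>j\<le>i. X j = l ! j})"
        by (intro UN_I[of "map X [0..<Suc i]"]) (auto simp del: upt_Suc)
    qed auto
    also have "\<dots> \<in> sigma_sets UNIV ?G"
    proof (rule S.countable_UN'')
      show "{X. \<forall>j\<le>i. X j = l ! j} \<in> sigma_sets UNIV ?G" for l :: "int list"
        by (rule sigma_sets.Basic) blast
    qed (rule countableI_type)
    finally show ?thesis .
  qed
  show "sets path_space \<subseteq> sigma_sets UNIV ?G"
    unfolding path_space_def sets_PiM_single
    using S.sigma_sets_subset[of "{{X. X i \<in> A} | i A. True}"] coord by force
  have "?G \<subseteq> sets path_space"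
    using cylinder_sets by auto
  moreover have "space path_space = UNIV"
    by (simp add: path_space_def space_PiM)
  ultimately show "sigma_sets UNIV ?G \<subseteq> sets path_space"
    using sets.sigma_sets_subset[of ?G path_space] by simp
qed

lemma Int_stable_cylinders:
  "Int_stable (insert {} {{X :: nat \<Rightarrow> int. \<forall>i\<le>n. X i = p i} | n p. True})"
proof -
  have "{X. \<forall>i\<le>n. X i = p i} \<inter> {X. \<forall>i\<le>m. X i = q i} \<in>
      insert {} {{X :: nat \<Rightarrow> int. \<forall>i\<le>n. X i = p i} | n p. True}" for n m p q
  proof (cases "\<forall>i\<le>min n m. p i = q i")
    case True
    then have "{X. \<forall>i\<le>n. X i = p i} \<inter> {X. \<forall>i\<le>m. X i = q i} =
        {X. \<forall>i\<le>max n m. X i = (if i \<le> n then p i else q i)}"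
    proof (intro set_eqI iffI)
      fix X assume *: "X \<in> {X. \<forall>i\<le>max n m. X i = (if i \<le> n then p i else q i)}"
      have "X i = p i" if "i \<le> n" for i using * that by auto
      moreover have "X i = q i" if "i \<le> m" for i
        using *[simplified, rule_format, of i] True that by (auto split: if_splits)
      ultimately show "X \<in> {X. \<forall>i\<le>n. X i = p i} \<inter> {X. \<forall>i\<le>m. X i = q i}" by blast
    qed auto
    then show ?thesis
      by (intro insertI2 CollectI exI conjI TrueI)
  next
    case False
    have "{X. \<forall>i\<le>n. X i = p i} \<inter> {X. \<forall>i\<le>m. X i = q i} = {}"
    proof -
      from False obtain i where i: "i \<le> n" "i \<le> m" "p i \<noteq> q i" 
        by (metis min.bounded_iff)
      show ?thesis
      proof (rule equals0I)
        fix X assume "X \<in> {X. \<forall>i\<le>n. X i = p i} \<inter> {X. \<forall>i\<le>m. X i = q i}"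
        with i(1,2) have "X i = p i" "X i = q i" by auto
        with i(3) show False by simp
      qed
    qed
    then show ?thesis by (simp only: insertI1)
  qed
  note cyl = this
  show ?thesis
  proof (rule Int_stableI)
    fix a b
    assume "a \<in> insert {} {{X :: nat \<Rightarrow> int. \<forall>i\<le>n. X i = p i} | n p. True}"
      and "b \<in> insert {} {{X :: nat \<Rightarrow> int. \<forall>i\<le>n. X i = p i} | n p. True}"
    then consider "a = {} \<or> b = {}"
      | n p m q where "a = {X. \<forall>i\<le>n. X i = p i}" "b = {X. \<forall>i\<le>m. X i = q i}"
      by (elim insertE CollectE exE conjE) simp_all
    then show "a \<inter> b \<in> insert {} {{X :: nat \<Rightarrow> int. \<forall>i\<le>n. X i = p i} | n p. True}"
    proof cases
      case 1
      then show ?thesis by auto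
    next
      case 2
      then show ?thesis using cyl by simp
    qed
  qed
qed

lemma measurable_quenched:
  "(\<lambda>\<omega>. quenched \<omega> x) \<in> measurable env_space (prob_algebra path_space)"
proof (rule measurable_prob_algebra_generated[OF sets_path_space_cylinders Int_stable_cylinders])
  show "insert {} {{X. \<forall>i\<le>n. X i = p i} | n p. True} \<subseteq> Pow (UNIV :: (nat \<Rightarrow> int) set)"
    by simp
  show "prob_space (quenched \<omega> x)" "sets (quenched \<omega> x) = sets path_space"
    if "\<omega> \<in> space env_space" for \<omega>
    using that by (simp_all add: prob_space_quenched sets_quenched)
  have ev: "(\<lambda>\<omega>. emeasure (\<omega> a) {b}) \<in> borel_measurable env_space" for a b
  proof -
    have "(\<lambda>\<omega>. \<omega> a) \<in> measurable env_space (subprob_algebra (count_space UNIV))"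
      unfolding env_space_def
      by (intro measurable_prob_algebraD measurable_component_singleton) simp
    from measurable_compose[OF this measurable_emeasure_subprob_algebra[of "{b}"]]
    show ?thesis by simp
  qed
  show "(\<lambda>\<omega>. emeasure (quenched \<omega> x) A) \<in> borel_measurable env_space"
    if "A \<in> insert {} {{X. \<forall>i\<le>n. X i = p i} | n p. True}" for A
    using that ev by (auto simp: emeasure_quenched_cylinder cong: measurable_cong)
qed

lemma emeasure_annealed:
  assumes "prob_space P" "sets P = sets env_space" "A \<in> sets path_space"
  shows "emeasure (annealed P x) A = (\<integral>\<^sup>+\<omega>. emeasure (quenched \<omega> x) A \<partial>P)"
proof -
  have "(\<lambda>\<omega>. quenched \<omega> x) \<in> measurable P (subprob_algebra path_space)"
    using measurable_prob_algebraD[OF measurable_quenched]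
    by (simp add: measurable_cong_sets[OF assms(2)])
  then show ?thesis
    unfolding annealed_def
    using assms prob_space.not_empty by (intro emeasure_bind) auto
qed

end

(*
  Write T(k) for the first time the walk is at or above k.

  If E T(1) is finite, then T(k + 1) - T(k) vanishes unless the walk enters [k, oo) at k, so its
  quenched mean is at most that of T(k + 1) for the walk started at k. Hence E T(k) <= k E T(1), and by
  Fatou liminf T(k)/k is almost surely finite, which excludes v = 0.

  If v > 0, then T(k)/k is eventually bounded. The entrance point into [K, oo) is correlated with the
  trapping environment to the left of K, so one cannot simply compare with a walk started at K.
  Instead, from the entrance point K + i the walk follows a fixed self-avoiding path inside the fresh
  environment on [K, K + S) to a fixed site K - l: this costs a factor independent of the past, and
  since [K, oo) is entered with probability one, the expected truncated time spent
  between T(K) and T(K + S) is at least c E min(N, T(1)), uniformly in K. Averaging over blocks and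
  letting N tend to infinity bounds E T(1).
*)

theory Submission
  imports Defs
begin

section \<open>The walk in a fixed environment\<close>

text \<open>Truncation at N is what permits averaging: block times are then bounded by N, so the
  reverse Fatou inequality turns a pathwise bound on T(k)/k into one on means, and that bound does
  not involve N. The detour ends at a site \<open>K - l\<close> common to all entrance points. The
  mean truncated time from \<open>K - l\<close> to \<open>K\<close> is then a single function of the
  environment below \<open>K\<close>, and it factors out of the sum of the entrance probabilities,
  which is at least 1 in almost every environment. It may be correlated with them; independence is
  used only between this product (sites below \<open>K\<close>) and the jumps of the detour (sites
  from \<open>K\<close> on). The detour must not leave a site twice: for two different jumps at one
  site the mean of the product of their probabilities can vanish although both means are positive,
  while at distinct sites it is the product of the means. The detour exists by irreducibility: every
  integer is a sum of jumps with positive mean probability. The entrance time is handled by summing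
  over its deterministic values, so the Markov property is needed at fixed times only.\<close>

definition shift_path :: "nat \<Rightarrow> (nat \<Rightarrow> int) \<Rightarrow> nat \<Rightarrow> int" where
  "shift_path n X = (\<lambda>i. X (n + i))"

lemma shift_path_apply [simp]: "shift_path n X i = X (n + i)"
  by (simp add: shift_path_def)

text \<open>An entrance into \<open>[k, \<infinity>)\<close> only when \<open>k \<le> z\<close>;
  that bound is left to the places of use, where \<open>z\<close> is typically \<open>k\<close> or
  \<open>k + i\<close>.\<close>

definition first_hit :: "int \<Rightarrow> nat \<Rightarrow> int \<Rightarrow> (nat \<Rightarrow> int) set" where
  "first_hit k n z = {X. (\<forall>i<n. X i < k) \<and> X n = z}"

definition stay_below :: "int \<Rightarrow> nat \<Rightarrow> (nat \<Rightarrow> int) set" where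
  "stay_below k m = {X. \<forall>i\<le>m. X i < k}"

abbreviation hit_time :: "int \<Rightarrow> (nat \<Rightarrow> int) \<Rightarrow> ennreal" where
  "hit_time k X \<equiv> ennreal_of_enat (hit_ge k X)"

text \<open>This is min(N, T(k)), written as the sum of the indicators of T(k) > m: each summand
  depends on finitely many positions, and monotonicity in \<open>N\<close> and \<open>k\<close> is
  visible term by term.\<close>

definition trunc_hit :: "int \<Rightarrow> nat \<Rightarrow> (nat \<Rightarrow> int) \<Rightarrow> ennreal" where
  "trunc_hit k N X = (\<Sum>m<N. indicator (stay_below k m) X)"

text \<open>The events determined by the positions up to time \<open>n\<close>. One implication
  suffices, since \<open>X\<close> and \<open>Y\<close> can be exchanged.\<close>

definition prefix_event :: "nat \<Rightarrow> (nat \<Rightarrow> int) set \<Rightarrow> bool" where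
  "prefix_event n A \<longleftrightarrow> (\<forall>X Y. (\<forall>i\<le>n. X i = Y i) \<longrightarrow> X \<in> A \<longrightarrow> Y \<in> A)"

definition cylinder :: "nat \<Rightarrow> (nat \<Rightarrow> int) \<Rightarrow> (nat \<Rightarrow> int) set" where
  "cylinder n p = {X. \<forall>i\<le>n. X i = p i}"

lemma mem_cylinder [simp]: "X \<in> cylinder n p \<longleftrightarrow> (\<forall>i\<le>n. X i = p i)"
  by (simp add: cylinder_def)

lemma space_path_space [simp]: "space path_space = UNIV"
  by (simp add: path_space_def space_PiM)

lemma measurable_coord [measurable]: "(\<lambda>X. X n) \<in> measurable path_space (count_space UNIV)"
  unfolding path_space_def by (rule measurable_component_singleton) simp

lemma measurable_shift_path [measurable]: "shift_path n \<in> measurable path_space path_space"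
  unfolding shift_path_def
  by (subst (2) path_space_def, rule measurable_PiM_single') (auto simp: space_PiM)

lemma sets_first_hit [measurable]: "first_hit k n z \<in> sets path_space"
proof -
  have "{X \<in> space path_space. (\<forall>i<n. X i < k) \<and> X n = z} \<in> sets path_space"
    by measurable
  then show ?thesis by (simp add: first_hit_def)
qed

lemma sets_stay_below [measurable]: "stay_below k m \<in> sets path_space"
proof -
  have "{X \<in> space path_space. \<forall>i\<le>m. X i < k} \<in> sets path_space"
    by measurable
  then show ?thesis by (simp add: stay_below_def)
qed

lemma measurable_trunc_hit [measurable]: "trunc_hit k N \<in> borel_measurable path_space"
  unfolding trunc_hit_def [abs_def] by measurable

section \<open>Hitting times and their truncations\<close>

lemma hit_ge_eq_Least:
  assumes "X n \<ge> k"
  shows "hit_ge k X = enat (LEAST n. X n \<ge> k)"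
proof -
  have "(LEAST n. X n \<ge> k) \<in> {n. X n \<ge> k}"
    using assms by (auto intro: LeastI)
  then show ?thesis
    unfolding hit_ge_def by (intro cInf_eq_minimum) (auto intro: Least_le)
qed

lemma hit_ge_eq_enat_iff: "hit_ge k X = enat n \<longleftrightarrow> (\<forall>i<n. X i < k) \<and> X n \<ge> k"
proof
  assume *: "hit_ge k X = enat n"
  then obtain m where m: "X m \<ge> k"
    by (force simp: hit_ge_def top_enat_def)
  have n: "n = (LEAST n. X n \<ge> k)" using * hit_ge_eq_Least[of k X, OF m] by simp
  show "(\<forall>i<n. X i < k) \<and> X n \<ge> k"
    unfolding n using LeastI[of "\<lambda>n. X n \<ge> k", OF m] by (auto dest!: not_less_Least)
next
  assume *: "(\<forall>i<n. X i < k) \<and> X n \<ge> k"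
  then have "(LEAST n. X n \<ge> k) = n"
    by (intro Least_equality) (auto simp: not_less[symmetric])
  then show "hit_ge k X = enat n" using hit_ge_eq_Least[of k X n] * by simp
qed

lemma hit_ge_eq_infinity_iff: "hit_ge k X = \<infinity> \<longleftrightarrow> (\<forall>n. X n < k)"
proof
  assume "hit_ge k X = \<infinity>"
  then show "\<forall>n. X n < k" using hit_ge_eq_Least[of k X] by (metis enat.distinct(1) not_le)
next
  assume "\<forall>n. X n < k"
  then have "hit_ge k X \<noteq> enat n" for n by (auto simp: hit_ge_eq_enat_iff not_le)
  then show "hit_ge k X = \<infinity>" by (cases "hit_ge k X") auto
qed

text \<open>Tail-sum formula: T(k) counts the times m with m < T(k). A path that stays below
  \<open>k\<close> makes every summand 1, so the value infinity is included.\<close>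

lemma hit_time_eq_suminf: "hit_time k X = (\<Sum>m. indicator (stay_below k m) X)"
proof (cases "hit_ge k X")
  case (enat n)
  then have n: "\<forall>i<n. X i < k" "X n \<ge> k" by (auto simp: hit_ge_eq_enat_iff)
  have ind: "indicator (stay_below k m) X = (if m < n then 1 else 0 :: ennreal)" for m
    using n by (auto simp: stay_below_def indicator_def not_less)
  have "(\<Sum>m. indicator (stay_below k m) X) = (\<Sum>m<n. 1 :: ennreal)"
    unfolding ind by (subst suminf_finite[of "{..<n}"]) auto
  then show ?thesis by (simp add: enat)
next
  case infinity
  then have ind: "indicator (stay_below k m) X = (1 :: ennreal)" for m
    by (auto simp: stay_below_def hit_ge_eq_infinity_iff)
  show ?thesis unfolding ind
    by (subst suminf_eq_SUP) (auto simp: infinity ennreal_SUP_of_nat_eq_top)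
qed

lemma measurable_hit_time [measurable]: "hit_time k \<in> borel_measurable path_space"
  unfolding hit_time_eq_suminf [abs_def] by measurable

lemma trunc_hit_le_hit_time: "trunc_hit k N X \<le> hit_time k X"
  unfolding hit_time_eq_suminf trunc_hit_def by (rule sum_le_suminf) auto

lemma trunc_hit_le: "trunc_hit k N X \<le> of_nat N"
proof -
  have "trunc_hit k N X \<le> (\<Sum>m<N. 1)"
    unfolding trunc_hit_def by (rule sum_mono) (auto simp: indicator_def)
  then show ?thesis by simp
qed

lemma trunc_hit_mono: "k \<le> k' \<Longrightarrow> trunc_hit k N X \<le> trunc_hit k' N X"
  unfolding trunc_hit_def
  by (intro sum_mono) (auto simp: stay_below_def indicator_def intro: order.strict_trans2)

lemma nn_integral_hit_time_eq_SUP: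
  assumes "sets M = sets path_space"
  shows "(\<integral>\<^sup>+X. hit_time k X \<partial>M) = (SUP N. \<integral>\<^sup>+X. trunc_hit k N X \<partial>M)"
proof -
  have [measurable]: "trunc_hit k N \<in> borel_measurable M" for N
    by (simp add: measurable_cong_sets[OF assms])
  have "hit_time k X = (SUP N. trunc_hit k N X)" for X
    unfolding hit_time_eq_suminf trunc_hit_def by (rule suminf_eq_SUP)
  moreover have "incseq (\<lambda>N X. trunc_hit k N X)"
    by (auto simp: incseq_def le_fun_def trunc_hit_def intro!: sum_mono2)
  ultimately show ?thesis
    by (simp add: nn_integral_monotone_convergence_SUP)
qed

lemma hit_ge_shift:
  assumes "X \<in> first_hit k n z" "k \<le> k'"
  shows "hit_ge k' X = enat n + hit_ge k' (shift_path n X)"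
proof (cases "hit_ge k' (shift_path n X)")
  case (enat m)
  then have m: "\<forall>i<m. X (n + i) < k'" "X (n + m) \<ge> k'" by (auto simp: hit_ge_eq_enat_iff)
  have "X i < k'" if "i < n + m" for i
    using m(1)[rule_format, of "i - n"] assms that
    by (cases "i < n") (force simp: first_hit_def)+
  with m(2) have "hit_ge k' X = enat (n + m)" by (simp add: hit_ge_eq_enat_iff)
  then show ?thesis using enat by simp
next
  case infinity
  then have *: "\<forall>i. X (n + i) < k'" by (simp add: hit_ge_eq_infinity_iff)
  have "X i < k'" for i
    using *[rule_format, of "i - n"] assms by (cases "i < n") (force simp: first_hit_def)+
  then have "hit_ge k' X = \<infinity>" by (simp add: hit_ge_eq_infinity_iff)
  then show ?thesis using infinity by simp
qed

text \<open>Prepending steps below \<open>k'\<close> can only delay the passage of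
  \<open>k'\<close>. The left side does not count the n prepended steps, hence an
  inequality.\<close>

lemma trunc_hit_shift:
  assumes "\<And>i. i < n \<Longrightarrow> X i < k'" "k \<le> k'"
  shows "trunc_hit k N (shift_path n X) \<le> trunc_hit k' N X"
  unfolding trunc_hit_def
proof (rule sum_mono)
  fix m
  have "X \<in> stay_below k' m" if "shift_path n X \<in> stay_below k m"
  proof -
    have "X i < k'" if "i \<le> m" for i
      using assms \<open>shift_path n X \<in> stay_below k m\<close> that
      by (cases "i < n") (force simp: stay_below_def dest!: spec[of _ "i - n"])+
    then show ?thesis by (simp add: stay_below_def)
  qed
  then show "indicator (stay_below k m) (shift_path n X) \<le> (indicator (stay_below k' m) X :: ennreal)"
    by (auto simp: indicator_def)
qed

section \<open>Cylinders, the Markov property and locality\<close>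

lemma sets_cylinder [measurable]: "cylinder n p \<in> sets path_space"
  unfolding cylinder_def by (rule cylinder_sets)

lemmas emeasure_cylinder = emeasure_quenched_cylinder[folded cylinder_def]

text \<open>Lists of length \<open>Suc n\<close> serve as indices because they form a countable
  type. By \<open>prefix_event\<close>, membership of \<open>(!) l\<close> in \<open>A\<close> is
  independent of the unspecified values beyond the length.\<close>

lemma prefix_event_UN_cylinders:
  assumes "prefix_event n A"
  shows "A = (\<Union>l\<in>{l. length l = Suc n \<and> (!) l \<in> A}. cylinder n ((!) l))" (is "_ = (\<Union>l\<in>?I. _)")
proof (intro set_eqI iffI)
  fix X assume "X \<in> A"
  define l where "l = map X [0..<Suc n]"
  have len: "length l = Suc n" by (simp add: l_def)
  have nth: "\<forall>i\<le>n. X i = l ! i"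
    unfolding l_def by (simp del: upt_Suc)
  have "(!) l \<in> A"
    using assms \<open>X \<in> A\<close> nth unfolding prefix_event_def by blast
  moreover have "X \<in> cylinder n ((!) l)" using nth by simp
  ultimately show "X \<in> (\<Union>l\<in>?I. cylinder n ((!) l))" using len by blast
next
  fix X assume "X \<in> (\<Union>l\<in>?I. cylinder n ((!) l))"
  then obtain l where l: "(!) l \<in> A" "X \<in> cylinder n ((!) l)" by blast
  have "\<forall>i\<le>n. l ! i = X i" using l(2) by simp
  then show "X \<in> A" using assms l(1) unfolding prefix_event_def by blast
qed

lemma disjoint_cylinders:
  "disjoint_family_on (\<lambda>l. cylinder n ((!) l)) {l. length l = Suc n \<and> (!) l \<in> A}"
  unfolding disjoint_family_on_def
proof (intro ballI impI equals0I)
  fix l l' X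
  assume l: "l \<in> {l. length l = Suc n \<and> (!) l \<in> A}" "l' \<in> {l. length l = Suc n \<and> (!) l \<in> A}" "l \<noteq> l'"
    and X: "X \<in> cylinder n ((!) l) \<inter> cylinder n ((!) l')"
  have "l = l'" using l X by (intro nth_equalityI) (auto simp: less_Suc_eq_le)
  with l show False by simp
qed

lemma sets_prefix_event:
  assumes "prefix_event n A"
  shows "A \<in> sets path_space"
proof -
  have "(\<Union>l\<in>{l. length l = Suc n \<and> (!) l \<in> A}. cylinder n ((!) l)) \<in> sets path_space"
    by (rule sets.countable_UN'') (rule countableI_type, rule sets_cylinder)
  then show ?thesis
    by (simp only: prefix_event_UN_cylinders[OF assms, symmetric])
qed

text \<open>Cylinders are stable under intersection, and the starting points give a countable cover
  by cylinders of finite measure. Total mass 1 is not assumed, so the restricted and rescaled laws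
  of the Markov property are covered.\<close>

lemma path_measure_eqI:
  assumes sets: "sets M = sets path_space" "sets N = sets path_space"
    and eq: "\<And>n p. emeasure M (cylinder n p) = emeasure N (cylinder n p)"
    and fin: "\<And>n p. emeasure M (cylinder n p) \<noteq> \<infinity>"
  shows "M = N"
proof -
  let ?E = "insert {} {cylinder n p |n p. True}"
  let ?A = "range (\<lambda>z :: int. cylinder 0 (\<lambda>_. z))"
  show ?thesis
  proof (rule measure_eqI_generator_eq_countable[where E="?E" and A="?A" and \<Omega>=UNIV])
    show "Int_stable ?E" unfolding cylinder_def by (rule Int_stable_cylinders)
    show "emeasure M B = emeasure N B" if "B \<in> ?E" for B
      using that eq by (elim insertE CollectE exE conjE) simp_all
    show "sets M = sigma_sets UNIV ?E" "sets N = sigma_sets UNIV ?E"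
      using sets sets_path_space_cylinders by (simp_all add: cylinder_def)
    show "?A \<subseteq> ?E" by blast
    show "\<Union>?A = UNIV" by auto
    show "countable ?A" by (rule countable_image) simp
    show "emeasure M B \<noteq> \<infinity>" if "B \<in> ?A" for B
      using that fin by blast
  qed simp
qed

text \<open>The two prefixes share the position at time n and join to one prefix of length n + m,
  whose product of transition probabilities splits there. If \<open>q 0 \<noteq> p n\<close>, both
  sides are 0.\<close>

lemma quenched_shift_cylinder:
  assumes \<omega>: "\<omega> \<in> space env_space"
  shows "emeasure (quenched \<omega> x) (cylinder n p \<inter> shift_path n -` cylinder m q) =
    emeasure (quenched \<omega> x) (cylinder n p) * emeasure (quenched \<omega> (p n)) (cylinder m q)"
proof (cases "q 0 = p n")
  case True
  define r where "r i = (if i \<le> n then p i else q (i - n))" for i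
  have "cylinder n p \<inter> shift_path n -` cylinder m q = cylinder (n + m) r"
  proof (intro set_eqI iffI)
    fix X assume X: "X \<in> cylinder n p \<inter> shift_path n -` cylinder m q"
    have "X i = r i" if "i \<le> n + m" for i
    proof (cases "i \<le> n")
      case False
      then obtain j where j: "i = n + j" using le_Suc_ex[of n i] by auto
      then have "X (n + j) = q j" using X that by simp
      then show ?thesis using False j by (simp add: r_def)
    qed (use X in \<open>simp add: r_def\<close>)
    then show "X \<in> cylinder (n + m) r" by simp
  next
    fix X assume X: "X \<in> cylinder (n + m) r"
    have "X i = p i" if "i \<le> n" for i using X that by (simp add: r_def)
    moreover have "X (n + i) = q i" if "i \<le> m" for i
      using X that True by (cases "i = 0") (simp_all add: r_def)
    ultimately show "X \<in> cylinder n p \<inter> shift_path n -` cylinder m q" by simp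
  qed
  moreover have "(\<Prod>i<n + m. emeasure (\<omega> (r i)) {r (Suc i)}) =
      (\<Prod>i<n. emeasure (\<omega> (p i)) {p (Suc i)}) * (\<Prod>i<m. emeasure (\<omega> (q i)) {q (Suc i)})"
  proof -
    have "(\<Prod>i<n + m. emeasure (\<omega> (r i)) {r (Suc i)}) =
      (\<Prod>i<n. emeasure (\<omega> (r i)) {r (Suc i)}) * (\<Prod>i<m. emeasure (\<omega> (r (n + i))) {r (Suc (n + i))})"
      by (induction m) (simp_all add: mult.assoc)
    moreover have "r (n + i) = q i" for i using True by (simp add: r_def)
    ultimately show ?thesis by (simp add: r_def)
  qed
  moreover have "r 0 = p 0" by (simp add: r_def)
  ultimately show ?thesis
    using True by (simp add: emeasure_cylinder[OF \<omega>] mult.assoc)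
next
  case False
  then have "cylinder n p \<inter> shift_path n -` cylinder m q = {}" by fastforce
  then show ?thesis using False by (simp add: emeasure_cylinder[OF \<omega>])
qed

lemma quenched_markov_cylinder:
  assumes \<omega>: "\<omega> \<in> space env_space" and f: "f \<in> borel_measurable path_space"
  shows "(\<integral>\<^sup>+X. indicator (cylinder n p) X * f (shift_path n X) \<partial>quenched \<omega> x) =
    emeasure (quenched \<omega> x) (cylinder n p) * (\<integral>\<^sup>+X. f X \<partial>quenched \<omega> (p n))"
proof -
  let ?Q = "quenched \<omega> x"
  note s = sets_quenched[OF \<omega>]
  have sp [simp]: "space (quenched \<omega> y) = UNIV" for y
    using sets_eq_imp_space_eq[OF s] by simp
  note [measurable] = f
  note [measurable_cong] = s
  \<comment> \<open>As functions of \<open>f\<close> both sides are integrals against measures: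
    \<open>?M\<close> is the law of the shifted path on the cylinder, \<open>?N\<close> the rescaled
    law of a fresh walk from \<open>p n\<close>. It suffices to compare these on cylinders.\<close>
  let ?M = "distr (density ?Q (indicator (cylinder n p))) path_space (shift_path n)"
  let ?N = "density (quenched \<omega> (p n)) (\<lambda>_. emeasure ?Q (cylinder n p))"
  have eN: "emeasure ?N B = emeasure ?Q (cylinder n p) * emeasure (quenched \<omega> (p n)) B"
    if "B \<in> sets path_space" for B
    using that by (subst emeasure_density) (auto simp: s nn_integral_cmult_indicator)
  have eM: "emeasure ?M B = emeasure ?Q (cylinder n p \<inter> shift_path n -` B)"
    if [measurable]: "B \<in> sets path_space" for B
  proof -
    have [measurable]: "shift_path n -` B \<in> sets path_space"
      using measurable_sets[OF measurable_shift_path that] by simp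
    have "emeasure ?M B = emeasure (density ?Q (indicator (cylinder n p))) (shift_path n -` B)"
      by (subst emeasure_distr) auto
    also have "\<dots> = (\<integral>\<^sup>+X. indicator (cylinder n p) X * indicator (shift_path n -` B) X \<partial>?Q)"
      by (rule emeasure_density) measurable
    also have "\<dots> = (\<integral>\<^sup>+X. indicator (cylinder n p \<inter> shift_path n -` B) X \<partial>?Q)"
      by (simp only: indicator_inter_arith)
    also have "\<dots> = emeasure ?Q (cylinder n p \<inter> shift_path n -` B)"
      by (rule nn_integral_indicator) measurable
    finally show ?thesis .
  qed
  have "?M = ?N"
  proof (rule path_measure_eqI)
    fix m q
    show "emeasure ?M (cylinder m q) = emeasure ?N (cylinder m q)"
      by (simp add: eM eN sets_cylinder quenched_shift_cylinder[OF \<omega>])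
    interpret Q: prob_space ?Q by (rule prob_space_quenched[OF \<omega>])
    show "emeasure ?M (cylinder m q) \<noteq> \<infinity>"
      by (simp add: eM sets_cylinder)
  qed (simp_all add: s)
  have "(\<integral>\<^sup>+X. indicator (cylinder n p) X * f (shift_path n X) \<partial>?Q) = (\<integral>\<^sup>+X. f X \<partial>?M)"
    by (subst nn_integral_distr) (simp_all add: nn_integral_density)
  also have "\<dots> = emeasure ?Q (cylinder n p) * (\<integral>\<^sup>+X. f X \<partial>quenched \<omega> (p n))"
    unfolding \<open>?M = ?N\<close> by (simp add: nn_integral_density nn_integral_cmult)
  finally show ?thesis .
qed

lemma emeasure_quenched_prefix_event:
  assumes \<omega>: "\<omega> \<in> space env_space" and A: "prefix_event n A"
  shows "emeasure (quenched \<omega> x) A =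
    (\<integral>\<^sup>+l. emeasure (quenched \<omega> x) (cylinder n ((!) l)) \<partial>count_space {l. length l = Suc n \<and> (!) l \<in> A})"
  (is "_ = (\<integral>\<^sup>+l. _ \<partial>count_space ?I)")
proof -
  have "emeasure (quenched \<omega> x) (\<Union>l\<in>?I. cylinder n ((!) l)) =
      (\<integral>\<^sup>+l. emeasure (quenched \<omega> x) (cylinder n ((!) l)) \<partial>count_space ?I)"
    by (rule emeasure_UN_countable)
       (simp_all only: sets_quenched[OF \<omega>] sets_cylinder countableI_type disjoint_cylinders)
  then show ?thesis
    by (simp only: prefix_event_UN_cylinders[OF A, symmetric])
qed

text \<open>\<open>A\<close> splits into countably many cylinders, all at \<open>z\<close> at time
  \<open>n\<close>, so the factor from the walk restarted at \<open>z\<close> is common to all of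
  them.\<close>

lemma quenched_markov:
  assumes \<omega>: "\<omega> \<in> space env_space" and f: "f \<in> borel_measurable path_space"
    and A: "prefix_event n A" "\<And>X. X \<in> A \<Longrightarrow> X n = z"
  shows "(\<integral>\<^sup>+X. indicator A X * f (shift_path n X) \<partial>quenched \<omega> x) =
    emeasure (quenched \<omega> x) A * (\<integral>\<^sup>+X. f X \<partial>quenched \<omega> z)"
proof -
  let ?Q = "quenched \<omega> x" and ?I = "{l. length l = Suc n \<and> (!) l \<in> A}"
  note [measurable] = f
  note [measurable_cong] = sets_quenched[OF \<omega>]
  have UN: "A = (\<Union>l\<in>?I. cylinder n ((!) l))" by (rule prefix_event_UN_cylinders[OF A(1)])
  have sum: "emeasure ?Q A = (\<integral>\<^sup>+l. emeasure ?Q (cylinder n ((!) l)) \<partial>count_space ?I)"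
    by (rule emeasure_quenched_prefix_event[OF \<omega> A(1)])
  have "indicator A X * c = (\<integral>\<^sup>+l. indicator (cylinder n ((!) l)) X * c \<partial>count_space ?I)"
    for X and c :: ennreal
  proof (cases "X \<in> A")
    case True
    then obtain l where l: "l \<in> ?I" "X \<in> cylinder n ((!) l)" using UN by blast
    have "(\<integral>\<^sup>+l'. indicator (cylinder n ((!) l')) X * c \<partial>count_space ?I) =
        (\<integral>\<^sup>+l'. c * indicator {l} l' \<partial>count_space ?I)"
    proof (rule nn_integral_cong)
      fix l' assume "l' \<in> space (count_space ?I)"
      then have "X \<in> cylinder n ((!) l') \<longleftrightarrow> l' = l"
        using l disjoint_cylinders[of n A] unfolding disjoint_family_on_def by fastforce
      then show "indicator (cylinder n ((!) l')) X * c = c * indicator {l} l'"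
        by (auto simp: indicator_def simp del: mem_Collect_eq)
    qed
    also have "\<dots> = c"
      using l by (subst nn_integral_cmult_indicator) auto
    finally show ?thesis using True by simp
  next
    case False
    have "X \<notin> cylinder n ((!) l)" if "l \<in> ?I" for l
      using False UN that by blast
    then have "(\<integral>\<^sup>+l. indicator (cylinder n ((!) l)) X * c \<partial>count_space ?I) = (\<integral>\<^sup>+l. 0 \<partial>count_space ?I)"
      by (intro nn_integral_cong) (simp add: indicator_def del: mem_Collect_eq)
    then show ?thesis using False by simp
  qed
  then have "(\<integral>\<^sup>+X. indicator A X * f (shift_path n X) \<partial>?Q) =
      (\<integral>\<^sup>+X. \<integral>\<^sup>+l. indicator (cylinder n ((!) l)) X * f (shift_path n X) \<partial>count_space ?I \<partial>?Q)"
    by simp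
  also have "\<dots> = (\<integral>\<^sup>+l. \<integral>\<^sup>+X. indicator (cylinder n ((!) l)) X * f (shift_path n X) \<partial>?Q \<partial>count_space ?I)"
    by (rule nn_integral_count_space_nn_integral) (auto intro: countableI_type)
  also have "\<dots> = (\<integral>\<^sup>+l. emeasure ?Q (cylinder n ((!) l)) * (\<integral>\<^sup>+X. f X \<partial>quenched \<omega> z) \<partial>count_space ?I)"
    by (intro nn_integral_cong) (use A(2) in \<open>auto simp: quenched_markov_cylinder[OF \<omega> f]\<close>)
  also have "\<dots> = (\<integral>\<^sup>+l. emeasure ?Q (cylinder n ((!) l)) \<partial>count_space ?I) * (\<integral>\<^sup>+X. f X \<partial>quenched \<omega> z)"
    by (simp add: nn_integral_multc)
  also have "(\<integral>\<^sup>+l. emeasure ?Q (cylinder n ((!) l)) \<partial>count_space ?I) = emeasure ?Q A"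
    by (rule sum[symmetric])
  finally show ?thesis .
qed

text \<open>A cylinder up to time n uses the environment only at the positions before time n, hence
  the strict \<open>i < n\<close>: a walk entering \<open>[K, \<infinity>)\<close> at time n has not
  yet used any site there.\<close>

lemma quenched_local:
  assumes \<omega>: "\<omega> \<in> space env_space" "\<omega>' \<in> space env_space"
    and eq: "\<And>x. x \<in> S \<Longrightarrow> \<omega> x = \<omega>' x"
    and A: "prefix_event n A" "\<And>X i. X \<in> A \<Longrightarrow> i < n \<Longrightarrow> X i \<in> S"
  shows "emeasure (quenched \<omega> x) A = emeasure (quenched \<omega>' x) A"
proof -
  let ?I = "{l. length l = Suc n \<and> (!) l \<in> A}"
  show ?thesis
    unfolding emeasure_quenched_prefix_event[OF \<omega>(1) A(1)] emeasure_quenched_prefix_event[OF \<omega>(2) A(1)]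
  proof (rule nn_integral_cong)
    fix l assume l: "l \<in> space (count_space ?I)"
    have "\<omega> (l ! i) = \<omega>' (l ! i)" if "i < n" for i
      using l that A(2) eq by auto
    then show "emeasure (quenched \<omega> x) (cylinder n ((!) l)) = emeasure (quenched \<omega>' x) (cylinder n ((!) l))"
      by (simp add: emeasure_cylinder \<omega>)
  qed
qed

lemma AE_quenched_start:
  assumes \<omega>: "\<omega> \<in> space env_space"
  shows "AE X in quenched \<omega> x. X 0 = x"
proof -
  interpret prob_space "quenched \<omega> x" by (rule prob_space_quenched[OF \<omega>])
  have "emeasure (quenched \<omega> x) (cylinder 0 (\<lambda>_. x)) = 1"
    by (simp only: emeasure_cylinder[OF \<omega>]) simp
  then have "prob (cylinder 0 (\<lambda>_. x)) = 1" by (simp add: measure_def)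
  moreover have "cylinder 0 (\<lambda>_. x) \<in> events" by (simp only: sets_quenched[OF \<omega>] sets_cylinder)
  ultimately have "AE X in quenched \<omega> x. X \<in> cylinder 0 (\<lambda>_. x)"
    by (simp only: prob_eq_1)
  then show ?thesis by simp
qed

text \<open>The paths with a forbidden step at time \<open>n\<close> form a countable union of
  cylinders, each with a vanishing factor.\<close>

lemma AE_quenched_step:
  assumes \<omega>: "\<omega> \<in> space env_space"
  shows "AE X in quenched \<omega> x. \<forall>n. trans_prob \<omega> (X n) (X (Suc n)) > 0"
  unfolding AE_all_countable
proof
  fix n
  let ?A = "{X :: nat \<Rightarrow> int. trans_prob \<omega> (X n) (X (Suc n)) = 0}"
  let ?I = "{l. length l = Suc (Suc n) \<and> (!) l \<in> ?A}"
  have pre: "prefix_event (Suc n) ?A"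
    unfolding prefix_event_def by auto
  have "cylinder (Suc n) ((!) l) \<in> null_sets (quenched \<omega> x)" if "l \<in> ?I" for l
  proof (rule null_setsI)
    have "emeasure (\<omega> (l ! n)) {l ! Suc n} = 0"
      using that env_spaceD(1)[OF \<omega>, of "l ! n"]
      by (simp add: trans_prob_def finite_measure.emeasure_eq_measure prob_space.finite_measure)
    then show "emeasure (quenched \<omega> x) (cylinder (Suc n) ((!) l)) = 0"
      by (subst emeasure_cylinder[OF \<omega>]) simp
  qed (simp add: sets_quenched[OF \<omega>] sets_cylinder)
  then have "?A \<in> null_sets (quenched \<omega> x)"
    by (subst prefix_event_UN_cylinders[OF pre]) (rule null_sets_UN', auto intro: countableI_type)
  from AE_not_in[OF this] show "AE X in quenched \<omega> x. trans_prob \<omega> (X n) (X (Suc n)) > 0"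
    by (auto simp: trans_prob_def zero_less_measure_iff)
qed

section \<open>Measurability in the environment\<close>

lemma nn_integral_quenched_measurable [measurable]:
  assumes "f \<in> borel_measurable path_space"
  shows "(\<lambda>\<omega>. \<integral>\<^sup>+X. f X \<partial>quenched \<omega> x) \<in> borel_measurable env_space"
  by (rule measurable_compose[OF measurable_prob_algebraD[OF measurable_quenched]
        nn_integral_measurable_subprob_algebra[OF assms]])

lemma emeasure_quenched_measurable [measurable]:
  assumes "A \<in> sets path_space"
  shows "(\<lambda>\<omega>. emeasure (quenched \<omega> x) A) \<in> borel_measurable env_space"
  by (rule measurable_compose[OF measurable_prob_algebraD[OF measurable_quenched]
        measurable_emeasure_subprob_algebra[OF assms]])

lemma measurable_env_coord [measurable]:
  "(\<lambda>\<omega>. \<omega> x) \<in> measurable env_space (prob_algebra (count_space UNIV))"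
  unfolding env_space_def by (rule measurable_component_singleton) simp

lemma measurable_env_spaceI:
  assumes "\<And>x. (\<lambda>\<eta>. f \<eta> x) \<in> measurable M (prob_algebra (count_space UNIV))"
  shows "f \<in> measurable M env_space"
  unfolding env_space_def
  by (rule measurable_PiM_single') (use assms measurable_space[OF assms] in \<open>auto simp: PiE_def extensional_def\<close>)

section \<open>Translation invariance and independence of sites\<close>

text \<open>Inverse of \<open>trans_vec\<close>: it rebuilds the environment from the recentred
  transition vectors, which are the objects assumed to be i.i.d.\<close>

definition env_of_vecs :: "(int \<Rightarrow> int measure) \<Rightarrow> int \<Rightarrow> int measure" where
  "env_of_vecs \<tau> x = distr (\<tau> x) (count_space UNIV) (\<lambda>w. w + x)"

text \<open>The environment seen from \<open>z\<close>, with both the sites and the targets of the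
  jumps recentred.\<close>

definition shift_env :: "int \<Rightarrow> (int \<Rightarrow> int measure) \<Rightarrow> int \<Rightarrow> int measure" where
  "shift_env z \<omega> x = distr (\<omega> (x + z)) (count_space UNIV) (\<lambda>w. w - z)"

lemma measurable_int_measure:
  "\<mu> \<in> space (prob_algebra (count_space UNIV)) \<Longrightarrow> f \<in> measurable \<mu> (count_space (UNIV :: int set))"
  for \<mu> :: "int measure"
  by (subst measurable_cong_sets[where M'="count_space UNIV" and N'="count_space UNIV"])
     (simp_all add: space_prob_algebra)

lemma emeasure_distr_int:
  assumes "\<mu> \<in> space (prob_algebra (count_space UNIV))"
  shows "emeasure (distr \<mu> (count_space (UNIV :: int set)) f) A = emeasure (\<mu> :: int measure) (f -` A)"
proof -
  have "space \<mu> = UNIV"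
    using assms sets_eq_imp_space_eq[of \<mu> "count_space UNIV"] by (simp add: space_prob_algebra)
  then show ?thesis by (subst emeasure_distr[OF measurable_int_measure[OF assms]]) simp_all
qed

lemma distr_distr_int:
  fixes f g :: "int \<Rightarrow> int"
  assumes "\<mu> \<in> space (prob_algebra (count_space (UNIV :: int set)))"
  shows "distr (distr \<mu> (count_space UNIV) f) (count_space UNIV) g =
    distr \<mu> (count_space (UNIV :: int set)) (\<lambda>w. g (f w))"
  by (subst distr_distr[OF _ measurable_int_measure[OF assms]]) (simp_all add: comp_def)

lemma env_space_coord:
  "\<omega> \<in> space env_space \<Longrightarrow> \<omega> x \<in> space (prob_algebra (count_space UNIV))"
  by (auto simp: env_space_def space_PiM)

lemma measurable_env_of_vecs [measurable]: "env_of_vecs \<in> measurable env_space env_space"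
  unfolding env_of_vecs_def
  by (rule measurable_env_spaceI)
     (rule measurable_compose[OF measurable_env_coord measurable_distr_prob_space], simp)

lemma measurable_trans_vec [measurable]: "trans_vec \<in> measurable env_space env_space"
  unfolding trans_vec_def
  by (rule measurable_env_spaceI)
     (rule measurable_compose[OF measurable_env_coord measurable_distr_prob_space], simp)

lemma measurable_shift_env [measurable]: "shift_env z \<in> measurable env_space env_space"
  unfolding shift_env_def
  by (rule measurable_env_spaceI)
     (rule measurable_compose[OF measurable_env_coord measurable_distr_prob_space], simp)

lemma env_of_vecs_trans_vec:
  assumes "\<omega> \<in> space env_space"
  shows "env_of_vecs (trans_vec \<omega>) = \<omega>"
proof
  fix x
  have s: "sets (\<omega> x) = sets (count_space UNIV)" using env_spaceD[OF assms] by simp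
  show "env_of_vecs (trans_vec \<omega>) x = \<omega> x"
    using distr_id2[OF s[symmetric]] by (simp add: env_of_vecs_def trans_vec_def distr_distr_int env_space_coord[OF assms])
qed

lemma shift_env_of_vecs:
  assumes "\<tau> \<in> space env_space"
  shows "shift_env z (env_of_vecs \<tau>) = env_of_vecs (\<lambda>x. \<tau> (x + z))"
  by (rule ext) (simp add: shift_env_def env_of_vecs_def distr_distr_int env_space_coord[OF assms] algebra_simps)

lemma emeasure_trans_vec:
  assumes "\<omega> \<in> space env_space"
  shows "emeasure (trans_vec \<omega> x) {j} = emeasure (\<omega> x) {x + j}"
proof -
  have "(\<lambda>z. z - x) -` {j} = {x + j}" by auto
  then show ?thesis
    by (simp add: trans_vec_def emeasure_distr_int env_space_coord[OF assms])
qed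

lemma quenched_shift_env:
  assumes \<omega>: "\<omega> \<in> space env_space"
  shows "quenched (shift_env z \<omega>) x = distr (quenched \<omega> (x + z)) path_space (\<lambda>X n. X n - z)"
proof -
  let ?\<omega> = "shift_env z \<omega>" and ?f = "\<lambda>X n. X n - z :: int"
  have \<omega>': "?\<omega> \<in> space env_space" using measurable_space[OF measurable_shift_env \<omega>] .
  have f: "?f \<in> measurable path_space path_space"
    by (subst (2) path_space_def, rule measurable_PiM_single') (auto simp: space_PiM)
  then have f': "?f \<in> measurable (quenched \<omega> (x + z)) path_space"
    by (simp add: measurable_cong_sets[OF sets_quenched[OF \<omega>]])
  have step: "emeasure (?\<omega> a) {b} = emeasure (\<omega> (a + z)) {b + z}" for a b
  proof -
    have "(\<lambda>w. w - z) -` {b} = {b + z}" by auto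
    then show ?thesis
      by (simp add: shift_env_def emeasure_distr_int env_space_coord[OF \<omega>])
  qed
  show ?thesis
  proof (rule path_measure_eqI)
    interpret prob_space "quenched ?\<omega> x" by (rule prob_space_quenched[OF \<omega>'])
    fix n p
    show "emeasure (quenched ?\<omega> x) (cylinder n p) \<noteq> \<infinity>" by simp
    have sp: "space (quenched \<omega> (x + z)) = UNIV"
      using sets_eq_imp_space_eq[OF sets_quenched[OF \<omega>]] by simp
    have "?f -` cylinder n p \<inter> space (quenched \<omega> (x + z)) = cylinder n (\<lambda>i. p i + z)"
      unfolding sp by (auto simp: cylinder_def algebra_simps)
    then have "emeasure (distr (quenched \<omega> (x + z)) path_space ?f) (cylinder n p) =
        emeasure (quenched \<omega> (x + z)) (cylinder n (\<lambda>i. p i + z))"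
      using f' by (subst emeasure_distr) simp_all
    also have "\<dots> = emeasure (quenched ?\<omega> x) (cylinder n p)"
      by (simp add: emeasure_cylinder \<omega> \<omega>' step indicator_def)
    finally show "emeasure (quenched ?\<omega> x) (cylinder n p) =
        emeasure (distr (quenched \<omega> (x + z)) path_space ?f) (cylinder n p)" by simp
  qed (simp_all add: sets_quenched[OF \<omega>'])
qed

section \<open>Stationarity and independence in an i.i.d. environment\<close>

locale iid_env = prob_space P for P :: "(int \<Rightarrow> int measure) measure" +
  assumes sets_P [measurable_cong]: "sets P = sets env_space"
    and indep: "indep_vars (\<lambda>_. prob_algebra (count_space UNIV)) (\<lambda>x \<omega>. trans_vec \<omega> x) UNIV"
    and ident: "distr P (prob_algebra (count_space UNIV)) (\<lambda>\<omega>. trans_vec \<omega> x) =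
      distr P (prob_algebra (count_space UNIV)) (\<lambda>\<omega>. trans_vec \<omega> y)"
begin

lemma space_P: "space P = space env_space"
  by (rule sets_eq_imp_space_eq[OF sets_P])

definition vec_law :: "(int \<Rightarrow> int measure) measure" where
  "vec_law = PiM UNIV (\<lambda>_. distr P (prob_algebra (count_space UNIV)) (\<lambda>\<omega>. trans_vec \<omega> 0))"

lemma measurable_trans_vec_coord: "(\<lambda>\<omega>. trans_vec \<omega> x) \<in> measurable P (prob_algebra (count_space UNIV))"
  using measurable_compose[OF measurable_trans_vec measurable_env_coord, of x]
  by (simp add: measurable_cong_sets[OF sets_P])

lemma sets_vec_law [measurable_cong]: "sets vec_law = sets env_space"
  unfolding vec_law_def env_space_def by (rule sets_PiM_cong) simp_all

lemma distr_trans_vec: "distr P env_space trans_vec = vec_law"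
proof -
  have "distr P (PiM UNIV (\<lambda>_. prob_algebra (count_space UNIV))) (\<lambda>\<omega>. \<lambda>x\<in>UNIV. trans_vec \<omega> x) =
      PiM UNIV (\<lambda>x. distr P (prob_algebra (count_space UNIV)) (\<lambda>\<omega>. trans_vec \<omega> x))"
    using indep by (subst (asm) indep_vars_iff_distr_eq_PiM) (auto intro: measurable_trans_vec_coord)
  also have "\<dots> = vec_law" unfolding vec_law_def using ident by (intro PiM_cong) auto
  finally show ?thesis by (simp add: env_space_def restrict_def)
qed

text \<open>The i.i.d. hypothesis says that the transition vectors have a product law, and the
  environment is a measurable function of them.\<close>

lemma P_eq_distr: "P = distr vec_law env_space env_of_vecs"
proof -
  have "distr vec_law env_space env_of_vecs = distr P env_space (env_of_vecs \<circ> trans_vec)"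
    unfolding distr_trans_vec[symmetric] by (rule distr_distr) measurable
  also have "\<dots> = distr P P (\<lambda>\<omega>. \<omega>)"
    by (rule distr_cong) (simp_all add: sets_P space_P env_of_vecs_trans_vec)
  finally show ?thesis by (simp add: distr_id2)
qed

lemma distr_vec_law_translate: "distr vec_law env_space (\<lambda>\<tau> x. \<tau> (x + z)) = vec_law"
proof -
  let ?\<nu> = "distr P (prob_algebra (count_space UNIV)) (\<lambda>\<omega>. trans_vec \<omega> 0)"
  have "distr (PiM UNIV (\<lambda>_ :: int. ?\<nu>)) (PiM UNIV (\<lambda>_. ?\<nu>)) (\<lambda>\<tau>. \<lambda>x\<in>UNIV. \<tau> (x + z)) = PiM UNIV (\<lambda>_. ?\<nu>)"
    using measurable_trans_vec_coord[of 0]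
    by (intro distr_PiM_reindex) (auto intro: prob_space_distr simp: inj_on_def)
  then have "distr vec_law vec_law (\<lambda>\<tau> x. \<tau> (x + z)) = vec_law"
    unfolding vec_law_def restrict_def by simp
  then show ?thesis
    by (simp add: distr_cong[OF refl sets_vec_law refl])
qed

text \<open>On the level of transition vectors, shifting the environment is a reindexing of an
  i.i.d. family, which preserves the product law.\<close>

lemma distr_shift_env: "distr P env_space (shift_env z) = P"
proof -
  have [measurable]: "(\<lambda>\<tau> x. \<tau> (x + z)) \<in> measurable env_space env_space"
    by (rule measurable_env_spaceI) measurable
  have "distr P env_space (shift_env z) = distr vec_law env_space (shift_env z \<circ> env_of_vecs)"
    by (subst P_eq_distr, rule distr_distr) measurable
  also have "\<dots> = distr vec_law env_space (env_of_vecs \<circ> (\<lambda>\<tau> x. \<tau> (x + z)))"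
    by (rule distr_cong) (simp_all add: sets_eq_imp_space_eq[OF sets_vec_law] shift_env_of_vecs)
  also have "\<dots> = distr (distr vec_law env_space (\<lambda>\<tau> x. \<tau> (x + z))) env_space env_of_vecs"
    by (rule distr_distr[symmetric]) measurable
  also have "\<dots> = P" by (simp only: distr_vec_law_translate P_eq_distr[symmetric])
  finally show ?thesis .
qed

lemma nn_integral_quenched_shift:
  assumes f [measurable]: "f \<in> borel_measurable path_space"
  shows "(\<integral>\<^sup>+\<omega>. \<integral>\<^sup>+X. f (\<lambda>n. X n - z) \<partial>quenched \<omega> (x + z) \<partial>P) = (\<integral>\<^sup>+\<omega>. \<integral>\<^sup>+X. f X \<partial>quenched \<omega> x \<partial>P)"
proof -
  have "(\<integral>\<^sup>+\<omega>. \<integral>\<^sup>+X. f X \<partial>quenched \<omega> x \<partial>P) =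
      (\<integral>\<^sup>+\<omega>. \<integral>\<^sup>+X. f X \<partial>quenched \<omega> x \<partial>distr P env_space (shift_env z))"
    by (simp only: distr_shift_env)
  also have "\<dots> = (\<integral>\<^sup>+\<omega>. \<integral>\<^sup>+X. f X \<partial>quenched (shift_env z \<omega>) x \<partial>P)"
    by (rule nn_integral_distr) measurable
  also have "\<dots> = (\<integral>\<^sup>+\<omega>. \<integral>\<^sup>+X. f (\<lambda>n. X n - z) \<partial>quenched \<omega> (x + z) \<partial>P)"
  proof (rule nn_integral_cong)
    fix \<omega> assume "\<omega> \<in> space P"
    then have \<omega>: "\<omega> \<in> space env_space" by (simp add: space_P)
    have "(\<lambda>X n. X n - z) \<in> measurable path_space path_space"
      by (subst (2) path_space_def, rule measurable_PiM_single') (auto simp: space_PiM)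
    then have "(\<lambda>X n. X n - z) \<in> measurable (quenched \<omega> (x + z)) path_space"
      by (simp add: measurable_cong_sets[OF sets_quenched[OF \<omega>]])
    then show "(\<integral>\<^sup>+X. f X \<partial>quenched (shift_env z \<omega>) x) = (\<integral>\<^sup>+X. f (\<lambda>n. X n - z) \<partial>quenched \<omega> (x + z))"
      unfolding quenched_shift_env[OF \<omega>] by (rule nn_integral_distr) simp
  qed
  finally show ?thesis ..
qed

lemma nn_integral_indep_sites:
  assumes F [measurable]: "F \<in> borel_measurable env_space" and G [measurable]: "G \<in> borel_measurable env_space"
    and FS: "\<And>\<omega> \<omega>'. \<omega> \<in> space env_space \<Longrightarrow> \<omega>' \<in> space env_space \<Longrightarrow> (\<And>x. x \<in> S \<Longrightarrow> \<omega> x = \<omega>' x) \<Longrightarrow> F \<omega> = F \<omega>'"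
    and GS: "\<And>\<omega> \<omega>'. \<omega> \<in> space env_space \<Longrightarrow> \<omega>' \<in> space env_space \<Longrightarrow> (\<And>x. x \<notin> S \<Longrightarrow> \<omega> x = \<omega>' x) \<Longrightarrow> G \<omega> = G \<omega>'"
  shows "(\<integral>\<^sup>+\<omega>. F \<omega> * G \<omega> \<partial>P) = (\<integral>\<^sup>+\<omega>. F \<omega> \<partial>P) * (\<integral>\<^sup>+\<omega>. G \<omega> \<partial>P :: ennreal)"
proof -
  let ?M = "\<lambda>_ :: int. prob_algebra (count_space (UNIV :: int set))"
  define K where "K b = (if b then S else - S)" for b
  \<comment> \<open>Independence is available for the vectors restricted to \<open>S\<close> and to
    its complement, but \<open>F\<close> and \<open>G\<close> take full environments. The default
    vector, a point mass at 0, fills the missing sites without changing the value of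
    \<open>F\<close> or \<open>G\<close>.\<close>
  define \<tau>0 :: "int \<Rightarrow> int measure" where "\<tau>0 = (\<lambda>_. return (count_space UNIV) 0)"
  have \<tau>0: "\<tau>0 x \<in> space (?M x)" for x
    by (simp add: \<tau>0_def space_prob_algebra prob_space_return)
  define E where "E b \<eta> x = (if x \<in> K b then \<eta> x else \<tau>0 x)" for b and \<eta> :: "int \<Rightarrow> int measure" and x
  have E [measurable]: "E b \<in> measurable (PiM (K b) ?M) env_space" for b
  proof (rule measurable_env_spaceI)
    fix x show "(\<lambda>\<eta>. E b \<eta> x) \<in> measurable (PiM (K b) ?M) (?M x)"
      unfolding E_def using \<tau>0[of x] by (cases "x \<in> K b") (simp_all add: measurable_component_singleton)
  qed
  define Y where "Y b \<eta> = (if b then F else G) (env_of_vecs (E b \<eta>))" for b \<eta>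
  have Y: "Y b \<in> borel_measurable (PiM (K b) ?M)" for b
    unfolding Y_def by (cases b) simp_all
  define Z where "Z b \<omega> = Y b (\<lambda>x\<in>K b. trans_vec \<omega> x)" for b \<omega>
  have "indep_vars (\<lambda>b. PiM (K b) ?M) (\<lambda>b \<omega>. \<lambda>x\<in>K b. trans_vec \<omega> x) UNIV"
    by (rule indep_vars_restrict[OF indep]) (auto simp: K_def disjoint_family_on_def)
  from indep_vars_compose2[OF this, of Y "\<lambda>_. borel"] Y
  have ind: "indep_vars (\<lambda>_. borel) Z UNIV" unfolding Z_def by simp
  have Z: "Z b \<omega> = (if b then F \<omega> else G \<omega>)" if "\<omega> \<in> space P" for b \<omega>
  proof -
    have \<omega>: "\<omega> \<in> space env_space" using that by (simp add: space_P)
    let ?\<omega> = "env_of_vecs (E b (\<lambda>x\<in>K b. trans_vec \<omega> x))"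
    have "(\<lambda>x\<in>K b. trans_vec \<omega> x) \<in> space (PiM (K b) ?M)"
      using env_space_coord[OF measurable_space[OF measurable_trans_vec \<omega>]] by (auto simp: space_PiM)
    then have \<omega>': "?\<omega> \<in> space env_space"
      using measurable_space[OF E] measurable_space[OF measurable_env_of_vecs] by blast
    have eq: "?\<omega> x = \<omega> x" if "x \<in> K b" for x
      using that fun_cong[OF env_of_vecs_trans_vec[OF \<omega>], of x] by (simp add: env_of_vecs_def E_def)
    show ?thesis
    proof (cases b)
      case True
      then have "F ?\<omega> = F \<omega>" by (intro FS[OF \<omega>' \<omega>] eq) (simp add: K_def)
      then show ?thesis using True by (simp add: Z_def Y_def)
    next
      case False
      then have "G ?\<omega> = G \<omega>" by (intro GS[OF \<omega>' \<omega>] eq) (simp add: K_def)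
      then show ?thesis using False by (simp add: Z_def Y_def)
    qed
  qed
  have "(\<integral>\<^sup>+\<omega>. F \<omega> * G \<omega> \<partial>P) = (\<integral>\<^sup>+\<omega>. (\<Prod>b\<in>UNIV. Z b \<omega>) \<partial>P)"
    by (intro nn_integral_cong) (simp add: Z UNIV_bool mult.commute)
  also have "\<dots> = (\<Prod>b\<in>UNIV. \<integral>\<^sup>+\<omega>. Z b \<omega> \<partial>P)"
    by (rule indep_vars_nn_integral[OF _ ind]) simp_all
  also have "\<dots> = (\<integral>\<^sup>+\<omega>. Z True \<omega> \<partial>P) * (\<integral>\<^sup>+\<omega>. Z False \<omega> \<partial>P)"
    by (simp add: UNIV_bool mult.commute)
  also have "\<dots> = (\<integral>\<^sup>+\<omega>. F \<omega> \<partial>P) * (\<integral>\<^sup>+\<omega>. G \<omega> \<partial>P)"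
    by (intro arg_cong2[where f=times] nn_integral_cong) (simp_all add: Z)
  finally show ?thesis .
qed

text \<open>The annealed probability of the jump \<open>j\<close>; it is the same at every site by
  \<open>nn_integral_step\<close>.\<close>

definition mean_step :: "int \<Rightarrow> ennreal" where
  "mean_step j = (\<integral>\<^sup>+\<omega>. emeasure (\<omega> 0) {j} \<partial>P)"

lemma measurable_step_prob [measurable]: "(\<lambda>\<omega>. emeasure (\<omega> a) {b}) \<in> borel_measurable env_space"
proof -
  have "(\<lambda>\<omega>. \<omega> a) \<in> measurable env_space (subprob_algebra (count_space UNIV))"
    by (intro measurable_prob_algebraD measurable_env_coord)
  from measurable_compose[OF this measurable_emeasure_subprob_algebra[of "{b}"]]
  show ?thesis by simp
qed

lemma measurable_emeasure_singleton:
  "(\<lambda>\<mu>. emeasure \<mu> {j}) \<in> borel_measurable (prob_algebra (count_space (UNIV :: int set)))"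
  by (rule measurable_compose[OF measurable_prob_algebraD[OF measurable_ident_sets[OF refl]]
        measurable_emeasure_subprob_algebra]) simp

lemma nn_integral_step: "(\<integral>\<^sup>+\<omega>. emeasure (\<omega> x) {x + j} \<partial>P) = mean_step j"
proof -
  have eq: "(\<integral>\<^sup>+\<omega>. emeasure (\<omega> y) {y + j} \<partial>P) =
      (\<integral>\<^sup>+\<mu>. emeasure \<mu> {j} \<partial>distr P (prob_algebra (count_space UNIV)) (\<lambda>\<omega>. trans_vec \<omega> y))" for y
  proof -
    have "(\<integral>\<^sup>+\<mu>. emeasure \<mu> {j} \<partial>distr P (prob_algebra (count_space UNIV)) (\<lambda>\<omega>. trans_vec \<omega> y)) =
        (\<integral>\<^sup>+\<omega>. emeasure (trans_vec \<omega> y) {j} \<partial>P)"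
      by (rule nn_integral_distr[OF measurable_trans_vec_coord])
         (simp only: measurable_distr_eq1 measurable_emeasure_singleton)
    also have "\<dots> = (\<integral>\<^sup>+\<omega>. emeasure (\<omega> y) {y + j} \<partial>P)"
      by (intro nn_integral_cong emeasure_trans_vec) (simp add: space_P)
    finally show ?thesis ..
  qed
  have "mean_step j = (\<integral>\<^sup>+\<omega>. emeasure (\<omega> 0) {0 + j} \<partial>P)"
    by (simp add: mean_step_def)
  then show ?thesis
    by (simp only: eq ident[of x 0])
qed

text \<open>No site is left twice, so the factors belong to distinct and hence independent
  transition vectors.\<close>

lemma nn_integral_distinct_steps:
  assumes p: "inj_on p {..<n}"
  shows "(\<integral>\<^sup>+\<omega>. (\<Prod>k<n. emeasure (\<omega> (p k)) {p (Suc k)}) \<partial>P) = (\<Prod>k<n. mean_step (p (Suc k) - p k))"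
proof -
  \<comment> \<open>The jump that the path makes on leaving the site \<open>x\<close>. It turns the
    product over times into one over sites, by which the independent family is indexed.\<close>
  define d where "d x = p (Suc (inv_into {..<n} p x)) - x" for x
  have d: "d (p k) = p (Suc k) - p k" if "k < n" for k
    using p that by (simp add: d_def)
  define Z where "Z x \<omega> = emeasure (trans_vec \<omega> x) {d x}" for x \<omega>
  have "indep_vars (\<lambda>_. borel) Z UNIV"
    unfolding Z_def
    by (rule indep_vars_compose2[OF indep, of "\<lambda>x \<mu>. emeasure \<mu> {d x}"]) (rule measurable_emeasure_singleton)
  then have ind: "indep_vars (\<lambda>_. borel) Z (p ` {..<n})"
    by (rule indep_vars_subset) simp
  have "(\<integral>\<^sup>+\<omega>. (\<Prod>k<n. emeasure (\<omega> (p k)) {p (Suc k)}) \<partial>P) = (\<integral>\<^sup>+\<omega>. (\<Prod>x\<in>p ` {..<n}. Z x \<omega>) \<partial>P)"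
  proof (rule nn_integral_cong)
    fix \<omega> assume "\<omega> \<in> space P"
    then have \<omega>: "\<omega> \<in> space env_space" by (simp add: space_P)
    show "(\<Prod>k<n. emeasure (\<omega> (p k)) {p (Suc k)}) = (\<Prod>x\<in>p ` {..<n}. Z x \<omega>)"
      unfolding prod.reindex[OF p] by (intro prod.cong) (simp_all add: Z_def emeasure_trans_vec[OF \<omega>] d)
  qed
  also have "\<dots> = (\<Prod>x\<in>p ` {..<n}. \<integral>\<^sup>+\<omega>. Z x \<omega> \<partial>P)"
    by (rule indep_vars_nn_integral[OF _ ind]) simp_all
  also have "\<dots> = (\<Prod>k<n. mean_step (p (Suc k) - p k))"
    unfolding prod.reindex[OF p] comp_def
  proof (intro prod.cong refl)
    fix k assume "k \<in> {..<n}"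
    have "(\<integral>\<^sup>+\<omega>. Z (p k) \<omega> \<partial>P) = (\<integral>\<^sup>+\<omega>. emeasure (\<omega> (p k)) {p k + (p (Suc k) - p k)} \<partial>P)"
      using \<open>k \<in> {..<n}\<close> by (intro nn_integral_cong) (simp add: Z_def space_P emeasure_trans_vec d)
    then show "(\<integral>\<^sup>+\<omega>. Z (p k) \<omega> \<partial>P) = mean_step (p (Suc k) - p k)"
      by (simp only: nn_integral_step)
  qed
  finally show ?thesis .
qed

lemma annealed_kernel: "(\<lambda>\<omega>. quenched \<omega> x) \<in> measurable P (subprob_algebra path_space)"
proof -
  have "measurable P (subprob_algebra path_space) = measurable env_space (subprob_algebra path_space)"
    by (rule measurable_cong_sets[OF sets_P refl])
  then show ?thesis using measurable_prob_algebraD[OF measurable_quenched, of x] by (simp only:)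
qed

lemma sets_annealed [measurable_cong]: "sets (annealed P x) = sets path_space"
  unfolding annealed_def by (rule sets_bind[OF sets_kernel[OF annealed_kernel] not_empty])

lemma nn_integral_annealed:
  "f \<in> borel_measurable path_space \<Longrightarrow>
    (\<integral>\<^sup>+X. f X \<partial>annealed P x) = (\<integral>\<^sup>+\<omega>. \<integral>\<^sup>+X. f X \<partial>quenched \<omega> x \<partial>P)"
  unfolding annealed_def by (rule nn_integral_bind[OF _ annealed_kernel])

lemma AE_annealed:
  "Measurable.pred path_space Q \<Longrightarrow> (AE X in annealed P x. Q X) \<longleftrightarrow> (AE \<omega> in P. AE X in quenched \<omega> x. Q X)"
  unfolding annealed_def by (rule AE_bind[OF annealed_kernel])

lemma prob_space_annealed: "prob_space (annealed P x)"
  unfolding annealed_def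
proof (rule prob_space_bind[OF _ annealed_kernel])
  show "AE \<omega> in P. prob_space (quenched \<omega> x)"
    by (rule AE_I2) (simp add: space_P prob_space_quenched)
qed

end

section \<open>Finite mean hitting time implies positive speed\<close>

lemma prefix_event_first_hit: "prefix_event n (first_hit k n z)"
  unfolding prefix_event_def first_hit_def by auto

lemma first_hit_iff: "X \<in> first_hit k n z \<longleftrightarrow> (\<forall>i<n. X i < k) \<and> X n = z"
  by (simp add: first_hit_def)

lemma first_hit_unique:
  assumes "X \<in> first_hit k n z" "X \<in> first_hit k n' z'" "k \<le> z" "k \<le> z'"
  shows "n = n'"
  using assms by (metis first_hit_iff linorder_not_le nat_neq_iff)

lemma term_le_suminf_ennreal: "f n \<le> (\<Sum>i. f i)" for f :: "nat \<Rightarrow> ennreal"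
  using sum_le_suminf[of f "{n}"] by simp

text \<open>The series has at most one nonzero term, at n = T(k); it stands in for a strong Markov
  property at that time. If T(k) is infinite, so is the right-hand side.\<close>

lemma hit_time_step:
  "hit_time (k + 1) X \<le> hit_time k X + (\<Sum>n. indicator (first_hit k n k) X * hit_time (k + 1) (shift_path n X))"
  (is "_ \<le> _ + (\<Sum>n. ?f n)")
proof (cases "hit_ge k X")
  case (enat n)
  then have n: "\<forall>i<n. X i < k" "X n \<ge> k" by (auto simp: hit_ge_eq_enat_iff)
  show ?thesis
  proof (cases "X n = k")
    case True
    then have fh: "X \<in> first_hit k n k" using n by (simp add: first_hit_iff)
    have "hit_time (k + 1) X = hit_time k X + ?f n"
      using fh enat by (simp add: hit_ge_shift[OF fh] ennreal_of_enat_plus)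
    also have "?f n \<le> (\<Sum>n. ?f n)"
      by (rule term_le_suminf_ennreal)
    finally show ?thesis by (simp add: add_left_mono)
  next
    case False
    then have "hit_ge (k + 1) X = enat n" using n by (auto simp: hit_ge_eq_enat_iff)
    then show ?thesis using enat by simp
  qed
qed simp

lemma suminf_first_hit_le_1:
  assumes \<omega>: "\<omega> \<in> space env_space"
  shows "(\<Sum>n. emeasure (quenched \<omega> x) (first_hit k n k)) \<le> 1"
proof -
  interpret prob_space "quenched \<omega> x" by (rule prob_space_quenched[OF \<omega>])
  have "(\<Sum>n. emeasure (quenched \<omega> x) (first_hit k n k)) = emeasure (quenched \<omega> x) (\<Union>n. first_hit k n k)"
    using first_hit_unique[of _ k _ k _ k]
    by (intro suminf_emeasure) (auto simp: sets_quenched[OF \<omega>] sets_first_hit disjoint_family_on_def)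
  also have "\<dots> \<le> 1" by (rule emeasure_le_1)
  finally show ?thesis .
qed

lemma nn_integral_hit_time_step:
  assumes \<omega>: "\<omega> \<in> space env_space"
  shows "(\<integral>\<^sup>+X. hit_time (k + 1) X \<partial>quenched \<omega> x) \<le>
    (\<integral>\<^sup>+X. hit_time k X \<partial>quenched \<omega> x) + (\<integral>\<^sup>+X. hit_time (k + 1) X \<partial>quenched \<omega> k)"
proof -
  let ?Q = "quenched \<omega> x"
  note [measurable_cong] = sets_quenched[OF \<omega>]
  have "(\<integral>\<^sup>+X. hit_time (k + 1) X \<partial>?Q) \<le>
      (\<integral>\<^sup>+X. hit_time k X + (\<Sum>n. indicator (first_hit k n k) X * hit_time (k + 1) (shift_path n X)) \<partial>?Q)"
    by (intro nn_integral_mono hit_time_step)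
  also have "\<dots> = (\<integral>\<^sup>+X. hit_time k X \<partial>?Q) +
      (\<Sum>n. \<integral>\<^sup>+X. indicator (first_hit k n k) X * hit_time (k + 1) (shift_path n X) \<partial>?Q)"
    by (subst nn_integral_add, measurable, subst nn_integral_suminf, measurable)
  also have "(\<Sum>n. \<integral>\<^sup>+X. indicator (first_hit k n k) X * hit_time (k + 1) (shift_path n X) \<partial>?Q) =
      (\<Sum>n. emeasure ?Q (first_hit k n k) * (\<integral>\<^sup>+X. hit_time (k + 1) X \<partial>quenched \<omega> k))"
    by (intro suminf_cong quenched_markov[OF \<omega> measurable_hit_time prefix_event_first_hit])
       (simp add: first_hit_iff)
  also have "\<dots> = (\<Sum>n. emeasure ?Q (first_hit k n k)) * (\<integral>\<^sup>+X. hit_time (k + 1) X \<partial>quenched \<omega> k)"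
    by (rule ennreal_suminf_multc)
  also have "\<dots> \<le> 1 * (\<integral>\<^sup>+X. hit_time (k + 1) X \<partial>quenched \<omega> k)"
    by (intro mult_right_mono suminf_first_hit_le_1[OF \<omega>]) simp
  finally show ?thesis by (simp add: add_left_mono)
qed

lemma hit_ge_translate: "hit_ge k (\<lambda>n. X n - z) = hit_ge (k + z) X"
  unfolding hit_ge_def by (intro arg_cong[where f=Inf] image_cong) auto

lemma trunc_hit_translate: "trunc_hit k N (\<lambda>n. X n - z) = trunc_hit (k + z) N X"
  unfolding trunc_hit_def stay_below_def indicator_def by (simp add: algebra_simps)

text \<open>The quenched estimate restarts the walk at \<open>k\<close> in the whole environment,
  without conditioning on how it got there; by stationarity each level then adds at most the mean of
  T(1).\<close>

lemma (in iid_env) nn_integral_hit_time_le: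
  "(\<integral>\<^sup>+X. hit_time (int k) X \<partial>annealed P 0) \<le> of_nat k * (\<integral>\<^sup>+X. hit_time 1 X \<partial>annealed P 0)"
proof (induction k)
  case 0
  have "AE \<omega> in P. AE X in quenched \<omega> 0. hit_time 0 X = 0"
  proof (rule AE_I2)
    fix \<omega> assume "\<omega> \<in> space P"
    then have "AE X in quenched \<omega> 0. X 0 = 0" by (simp add: space_P AE_quenched_start)
    then show "AE X in quenched \<omega> 0. hit_time 0 X = 0"
    proof eventually_elim
      case (elim X)
      then have "hit_ge 0 X = enat 0" by (simp add: hit_ge_eq_enat_iff)
      then show ?case by simp
    qed
  qed
  then have "AE X in annealed P 0. hit_time 0 X = 0"
    by (subst AE_annealed) simp_all
  then have "(\<integral>\<^sup>+X. hit_time 0 X \<partial>annealed P 0) = (\<integral>\<^sup>+X. 0 \<partial>annealed P 0)"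
    by (rule nn_integral_cong_AE)
  then show ?case by simp
next
  case (Suc k)
  have eq: "int (Suc k) = int k + 1" by simp
  have "(\<integral>\<^sup>+X. hit_time (int (Suc k)) X \<partial>annealed P 0) =
      (\<integral>\<^sup>+\<omega>. \<integral>\<^sup>+X. hit_time (int k + 1) X \<partial>quenched \<omega> 0 \<partial>P)"
    unfolding eq by (rule nn_integral_annealed) measurable
  also have "\<dots> \<le> (\<integral>\<^sup>+\<omega>. (\<integral>\<^sup>+X. hit_time (int k) X \<partial>quenched \<omega> 0) +
      (\<integral>\<^sup>+X. hit_time (int k + 1) X \<partial>quenched \<omega> (int k)) \<partial>P)"
    by (intro nn_integral_mono nn_integral_hit_time_step) (simp add: space_P)
  also have "\<dots> = (\<integral>\<^sup>+\<omega>. \<integral>\<^sup>+X. hit_time (int k) X \<partial>quenched \<omega> 0 \<partial>P) +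
      (\<integral>\<^sup>+\<omega>. \<integral>\<^sup>+X. hit_time (int k + 1) X \<partial>quenched \<omega> (int k) \<partial>P)"
    by (rule nn_integral_add) measurable
  also have "(\<integral>\<^sup>+\<omega>. \<integral>\<^sup>+X. hit_time (int k + 1) X \<partial>quenched \<omega> (int k) \<partial>P) =
      (\<integral>\<^sup>+\<omega>. \<integral>\<^sup>+X. hit_time 1 X \<partial>quenched \<omega> 0 \<partial>P)"
    using nn_integral_quenched_shift[OF measurable_hit_time[of 1], where z="int k" and x=0]
    by (simp only: hit_ge_translate add_0 add.commute[of 1])
  also have "(\<integral>\<^sup>+\<omega>. \<integral>\<^sup>+X. hit_time (int k) X \<partial>quenched \<omega> 0 \<partial>P) +
      (\<integral>\<^sup>+\<omega>. \<integral>\<^sup>+X. hit_time 1 X \<partial>quenched \<omega> 0 \<partial>P) =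
      (\<integral>\<^sup>+X. hit_time (int k) X \<partial>annealed P 0) + (\<integral>\<^sup>+X. hit_time 1 X \<partial>annealed P 0)"
    by (simp only: nn_integral_annealed measurable_hit_time)
  also have "\<dots> \<le> of_nat k * (\<integral>\<^sup>+X. hit_time 1 X \<partial>annealed P 0) + (\<integral>\<^sup>+X. hit_time 1 X \<partial>annealed P 0)"
    by (intro add_right_mono Suc.IH)
  also have "\<dots> = of_nat (Suc k) * (\<integral>\<^sup>+X. hit_time 1 X \<partial>annealed P 0)"
    by (simp add: algebra_simps)
  finally show ?case .
qed

text \<open>With zero speed, \<open>M * X n \<le> n\<close> for all large n, so a level
  \<open>k\<close> reached at such a time is reached no earlier than \<open>M * k\<close>. Levels
  above the maximum \<open>B\<close> of the early positions cannot be reached early.\<close>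

lemma hit_time_superlinear:
  assumes X: "(\<lambda>n. real_of_int (X n) / real n) \<longlonglongrightarrow> 0"
  shows "eventually (\<lambda>k. of_nat (M * k) \<le> hit_time (int k) X) sequentially"
proof (cases "M = 0")
  case False
  then have "0 < 1 / real M" by simp
  then have "eventually (\<lambda>n. real_of_int (X n) / real n < 1 / real M) sequentially"
    by (rule order_tendstoD(2)[OF X])
  then obtain n0 where n0: "real_of_int (X n) / real n < 1 / real M" if "n \<ge> n0" for n
    by (auto simp: eventually_sequentially)
  \<comment> \<open>The 1 keeps n positive, so that the division by n can be cleared.\<close>
  have le: "int M * X n \<le> int n" if "n \<ge> max 1 n0" for n
  proof -
    have "real_of_int (X n) * real M < real n"
      using n0[of n] that False by (simp add: field_simps)
    then have "real_of_int (int M * X n) < real_of_int (int n)" by (simp add: mult.commute)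
    then show ?thesis by linarith
  qed
  define B where "B = Max (insert 0 (X ` {..<max 1 n0}))"
  show ?thesis unfolding eventually_sequentially
  proof (intro exI[of _ "Suc (nat B)"] allI impI)
    fix k assume k: "Suc (nat B) \<le> k"
    show "of_nat (M * k) \<le> hit_time (int k) X"
    proof (cases "hit_ge (int k) X")
      case (enat n)
      then have n: "X n \<ge> int k" by (simp add: hit_ge_eq_enat_iff)
      have "n \<ge> max 1 n0"
      proof (rule ccontr)
        assume "\<not> n \<ge> max 1 n0"
        then have "X n \<le> B" unfolding B_def by (intro Max_ge) auto
        then show False using n k by linarith
      qed
      then have "int M * X n \<le> int n" by (rule le)
      moreover have "int M * int k \<le> int M * X n" using n by (intro mult_left_mono) auto
      ultimately have "M * k \<le> n" by (simp flip: of_nat_mult)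
      then show ?thesis using enat by (simp del: of_nat_mult)
    qed simp
  qed
qed simp

lemma (in iid_env) speed_pos_if_finite:
  assumes vel: "AE X in annealed P 0. (\<lambda>n. real_of_int (X n) / real n) \<longlonglongrightarrow> v"
    and tr: "AE \<omega> in P. AE X in quenched \<omega> 0. filterlim X at_top sequentially"
    and fin: "(\<integral>\<^sup>+X. hit_time 1 X \<partial>annealed P 0) < \<infinity>"
  shows "v > 0"
proof -
  interpret A: prob_space "annealed P 0" by (rule prob_space_annealed)
  have meas: "Measurable.pred path_space (\<lambda>X :: nat \<Rightarrow> int. filterlim X at_top sequentially)"
    unfolding filterlim_at_top eventually_sequentially by measurable
  have tr': "AE X in annealed P 0. filterlim X at_top sequentially"
    using tr by (subst AE_annealed[OF meas])
  \<comment> \<open>Transience to the right makes \<open>X n\<close> eventually nonnegative, which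
    rules out a negative limit.\<close>
  have "v \<ge> 0"
  proof -
    have "AE X in annealed P 0. v \<ge> 0"
      using vel tr'
    proof eventually_elim
      case (elim X)
      have "eventually (\<lambda>n. 0 \<le> X n) sequentially"
        using elim(2) by (simp add: filterlim_at_top)
      then have "eventually (\<lambda>n. 0 \<le> real_of_int (X n) / real n) sequentially"
        by eventually_elim simp
      then show ?case by (rule tendsto_lowerbound[OF elim(1)]) simp
    qed
    then show ?thesis by simp
  qed
  moreover have "v \<noteq> 0"
  proof
    assume "v = 0"
    let ?u = "\<lambda>k X. hit_time (int (Suc k)) X / of_nat (Suc k)"
    let ?a = "\<integral>\<^sup>+X. hit_time 1 X \<partial>annealed P 0"
    have "AE X in annealed P 0. liminf (\<lambda>k. ?u k X) = \<infinity>"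
      using vel unfolding \<open>v = 0\<close>
    proof eventually_elim
      case (elim X)
      \<comment> \<open>Zero speed forces T(k)/k to infinity: its liminf is at least every natural
        number.\<close>
      have bound: "of_nat M \<le> liminf (\<lambda>k. ?u k X)" for M
      proof (rule Liminf_bounded)
        have "eventually (\<lambda>k. of_nat (M * Suc k) \<le> hit_time (int (Suc k)) X) sequentially"
          using hit_time_superlinear[OF elim, of M] by (rule eventually_sequentially_Suc[THEN iffD2])
        then show "eventually (\<lambda>k. of_nat M \<le> ?u k X) sequentially"
        proof eventually_elim
          case (elim k)
          have "(of_nat M :: ennreal) = of_nat (M * Suc k) / of_nat (Suc k)"
            unfolding of_nat_mult by (subst ennreal_mult_divide_eq) (simp_all add: ennreal_of_nat_eq_real_of_nat)
          also have "\<dots> \<le> ?u k X" by (intro divide_right_mono_ennreal elim)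
          finally show ?case .
        qed
      qed
      have "(SUP M. of_nat M) \<le> liminf (\<lambda>k. ?u k X)"
        by (rule SUP_least) (rule bound)
      then show ?case
        by (simp only: ennreal_SUP_of_nat_eq_top top_unique infinity_ennreal_def)
    qed
    then have "(\<integral>\<^sup>+X. liminf (\<lambda>k. ?u k X) \<partial>annealed P 0) = (\<integral>\<^sup>+X. \<infinity> \<partial>annealed P 0)"
      by (rule nn_integral_cong_AE)
    also have "\<dots> = \<infinity>" by (simp add: A.emeasure_space_1)
    \<comment> \<open>Fatou's lemma makes the liminf of the means of T(k)/k infinite, while each of
      these means is at most \<open>?a\<close>.\<close>
    finally have "\<infinity> \<le> liminf (\<lambda>k. \<integral>\<^sup>+X. ?u k X \<partial>annealed P 0)"
      using nn_integral_liminf[of ?u "annealed P 0"] by simp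
    also have "\<dots> \<le> liminf (\<lambda>k. ?a)"
    proof (intro Liminf_mono always_eventually allI)
      fix k
      have "(\<integral>\<^sup>+X. ?u k X \<partial>annealed P 0) = (\<integral>\<^sup>+X. hit_time (int (Suc k)) X \<partial>annealed P 0) / of_nat (Suc k)"
        by (rule nn_integral_divide) measurable
      also have "\<dots> \<le> (of_nat (Suc k) * ?a) / of_nat (Suc k)"
        by (intro divide_right_mono_ennreal nn_integral_hit_time_le)
      also have "\<dots> = ?a"
        by (subst mult.commute, subst ennreal_mult_divide_eq) (simp_all add: ennreal_of_nat_eq_real_of_nat)
      finally show "(\<integral>\<^sup>+X. ?u k X \<partial>annealed P 0) \<le> ?a" .
    qed
    also have "\<dots> = ?a" by (simp add: Liminf_const)
    finally show False using fin by simp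
  qed
  ultimately show ?thesis by simp
qed

section \<open>Positive speed implies finite mean hitting time\<close>

lemma shortest_path:
  assumes "rel\<^sup>*\<^sup>* a b"
  obtains n p where "p 0 = a" "p n = b" "\<And>k. k < n \<Longrightarrow> rel (p k) (p (Suc k))" "inj_on p {..<n}"
proof -
  define n where "n = (LEAST n. (rel ^^ n) a b)"
  have "\<exists>n. (rel ^^ n) a b" using assms by (rule rtranclp_imp_relpowp)
  then have n: "(rel ^^ n) a b" unfolding n_def by (rule LeastI_ex)
  have min: "\<not> (rel ^^ m) a b" if "m < n" for m
    using that not_less_Least unfolding n_def by blast
  obtain p where p: "p 0 = a" "p n = b" "\<And>k. k < n \<Longrightarrow> rel (p k) (p (Suc k))"
    using n by (auto simp: relpowp_fun_conv)
  have "p s \<noteq> p t" if st: "s < t" "t < n" for s t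
  proof
    assume eq: "p s = p t"
    \<comment> \<open>Cutting out the loop between the times \<open>s\<close> and \<open>t\<close>
      gives a path shorter by \<open>t - s\<close>, against minimality.\<close>
    define q where "q k = (if k \<le> s then p k else p (k + (t - s)))" for k
    have "rel (q k) (q (Suc k))" if "k < n - (t - s)" for k
    proof -
      consider "k < s" | "k = s" | "k > s" by linarith
      then show ?thesis
      proof cases
        case 1
        then show ?thesis using p(3)[of k] st by (simp add: q_def)
      next
        case 2
        then have "Suc k + (t - s) = Suc t" using st by simp
        then show ?thesis using p(3)[of t] st eq 2 by (simp add: q_def)
      next
        case 3
        then show ?thesis using p(3)[of "k + (t - s)"] that st by (simp add: q_def)
      qed
    qed
    moreover have "q 0 = a" using p by (simp add: q_def)
    moreover have "q (n - (t - s)) = b"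
    proof -
      have "\<not> n - (t - s) \<le> s" "n - (t - s) + (t - s) = n" using st by auto
      then show ?thesis using p(2) by (simp add: q_def)
    qed
    ultimately have "(rel ^^ (n - (t - s))) a b" unfolding relpowp_fun_conv by blast
    moreover have "n - (t - s) < n" using st by simp
    ultimately show False using min by blast
  qed
  then have "inj_on p {..<n}"
    by (intro inj_onI) (metis lessThan_iff linorder_neqE_nat)
  with p show thesis by (rule that)
qed

text \<open>Nonnegative jumps come first and cannot leave the half-line; after a negative one all
  remaining jumps are nonpositive, so each later partial sum is at least the final one.\<close>

lemma rtranclp_nonneg_path:
  assumes "sorted_wrt (\<ge>) js" "set js \<subseteq> J" "x \<ge> 0" "x + sum_list js \<ge> (0 :: int)"
  shows "(\<lambda>a b. a \<ge> 0 \<and> b - a \<in> J)\<^sup>*\<^sup>* x (x + sum_list js)"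
  using assms
proof (induction js arbitrary: x)
  case (Cons j js)
  have "x + j \<ge> 0"
  proof (cases "j \<ge> 0")
    case False
    then have "\<forall>i\<in>set js. i \<le> 0" using Cons.prems(1) by fastforce
    then have "sum_list js \<le> 0" by (intro sum_list_nonpos) simp
    then show ?thesis using Cons.prems(4) by simp
  qed (use Cons.prems in simp)
  then have "(\<lambda>a b. a \<ge> 0 \<and> b - a \<in> J)\<^sup>*\<^sup>* (x + j) (x + j + sum_list js)"
    using Cons.prems by (intro Cons.IH) (simp_all add: add.assoc)
  moreover have "x \<ge> 0 \<and> (x + j) - x \<in> J" using Cons.prems by simp
  ultimately have "(\<lambda>a b. a \<ge> 0 \<and> b - a \<in> J)\<^sup>*\<^sup>* x (x + j + sum_list js)"
    by (rule converse_rtranclp_into_rtranclp[rotated])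
  then show ?case by (simp add: add.assoc)
qed simp

text \<open>
  Arranging the jumps in decreasing order keeps the path to \<open>0\<close> nonnegative; a shortest such path
  visits no site twice, which makes the jump probabilities along it independent.
\<close>

lemma self_avoiding_exit:
  assumes J: "\<And>d :: int. \<exists>js. set js \<subseteq> J \<and> sum_list js = d"
  obtains l where "l > (0 :: int)"
    and "\<And>i. i \<ge> 0 \<Longrightarrow> \<exists>n p. p 0 = i \<and> p n = - l \<and> (\<forall>k<n. p k \<ge> 0 \<and> p (Suc k) - p k \<in> J) \<and> inj_on p {..<n}"
proof -
  obtain js where js: "set js \<subseteq> J" "sum_list js = -1" using J by blast
  have "\<exists>j\<in>set js. j < 0"
  proof (rule ccontr)
    assume "\<not> ?thesis"
    then have "sum_list js \<ge> 0" by (intro sum_list_nonneg) (auto simp: not_less)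
    with js show False by simp
  qed
  then obtain j where j: "j \<in> J" "j < 0" using js by blast
  show thesis
  \<comment> \<open>From 0 the single negative jump \<open>j\<close> leads out of the half-line, so
    the same end point \<open>j\<close> can be used for every starting point
    \<open>i\<close>.\<close>
  proof (rule that[of "- j"])
    fix i :: int assume i: "i \<ge> 0"
    let ?rel = "\<lambda>a b. a \<ge> 0 \<and> b - a \<in> J"
    obtain js where js: "set js \<subseteq> J" "sum_list js = - i" using J by blast
    have "sum_list (rev (sort js)) = sum_mset (mset (rev (sort js)))" by (simp only: sum_mset_sum_list)
    also have "\<dots> = - i" using js by (simp add: sum_mset_sum_list)
    finally have sum: "sum_list (rev (sort js)) = - i" .
    have "?rel\<^sup>*\<^sup>* i (i + sum_list (rev (sort js)))"
      using js i sum by (intro rtranclp_nonneg_path) (simp_all add: sorted_wrt_rev)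
    then have "?rel\<^sup>*\<^sup>* i 0" unfolding sum by simp
    then have "?rel\<^sup>*\<^sup>* i j" using j by (auto intro: rtranclp.rtrancl_into_rtrancl)
    then obtain n p where "p 0 = i" "p n = j" "\<And>k. k < n \<Longrightarrow> ?rel (p k) (p (Suc k))" "inj_on p {..<n}"
      by (rule shortest_path) blast
    then show "\<exists>n p. p 0 = i \<and> p n = - (- j) \<and> (\<forall>k<n. p k \<ge> 0 \<and> p (Suc k) - p k \<in> J) \<and> inj_on p {..<n}"
      by auto
  qed (use j in simp)
qed

section \<open>Truncated time spent in blocks\<close>

definition block_time :: "int \<Rightarrow> int \<Rightarrow> nat \<Rightarrow> nat \<Rightarrow> (nat \<Rightarrow> int) \<Rightarrow> ennreal" where
  "block_time K S R N X = (\<Sum>n. \<Sum>i<R. indicator (first_hit K n (K + int i)) X * trunc_hit (K + S) N (shift_path n X))"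

lemma measurable_block_time [measurable]: "block_time K S R N \<in> borel_measurable path_space"
  unfolding block_time_def [abs_def] by measurable

text \<open>For each path at most one pair of \<open>n\<close> and \<open>i\<close> contributes to
  \<open>block_time\<close>, namely time and offset of the entrance into
  \<open>[K, \<infinity>)\<close>. Entrances beyond the first R sites are not counted, hence an
  inequality.\<close>

lemma block_time_le:
  "block_time K S R N X \<le> (case hit_ge K X of enat n \<Rightarrow> trunc_hit (K + S) N (shift_path n X) | \<infinity> \<Rightarrow> 0)"
proof (cases "hit_ge K X")
  case (enat n)
  then have n: "\<forall>i<n. X i < K" "X n \<ge> K" by (auto simp: hit_ge_eq_enat_iff)
  have zero: "X \<notin> first_hit K m (K + int i)" if "m \<noteq> n" for m i
    using first_hit_unique[of X K m "K + int i" n "X n"] n that by (auto simp: first_hit_iff)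
  let ?c = "trunc_hit (K + S) N (shift_path n X)"
  have "block_time K S R N X = (\<Sum>i<R. indicator (first_hit K n (K + int i)) X * ?c)"
    unfolding block_time_def by (subst suminf_finite[of "{n}"]) (auto simp: zero)
  also have "\<dots> \<le> (\<Sum>i<R. if i = nat (X n - K) then ?c else 0)"
    by (intro sum_mono) (auto simp: first_hit_iff indicator_def)
  also have "\<dots> \<le> ?c" by (simp add: sum.delta)
  finally show ?thesis using enat by simp
next
  case infinity
  then have "X n < K" for n by (simp add: hit_ge_eq_infinity_iff)
  then have "X \<notin> first_hit K n (K + int i)" for n i
    by (metis add_increasing2 first_hit_iff linorder_not_less of_nat_0_le_iff order_refl)
  then show ?thesis using infinity by (simp add: block_time_def)
qed

lemma block_time_le_of_nat: "block_time K S R N X \<le> of_nat N"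
  using block_time_le[of K S R N X] trunc_hit_le
  by (cases "hit_ge K X") (auto intro: order_trans)

lemma hit_time_block:
  assumes "S \<ge> 0"
  shows "hit_time K X + block_time K S R N X \<le> hit_time (K + S) X"
proof (cases "hit_ge K X")
  case (enat n)
  then have "X \<in> first_hit K n (X n)" by (simp add: hit_ge_eq_enat_iff first_hit_iff)
  then have "hit_ge (K + S) X = enat n + hit_ge (K + S) (shift_path n X)"
    using assms by (intro hit_ge_shift[of X K]) simp_all
  moreover have "block_time K S R N X \<le> hit_time (K + S) (shift_path n X)"
    using block_time_le[of K S R N X] trunc_hit_le_hit_time enat by (auto intro: order_trans)
  ultimately show ?thesis using enat by (simp add: add_left_mono)
next
  case infinity
  have "X n < K + S" for n
  proof -
    have "X n < K" using infinity by (simp add: hit_ge_eq_infinity_iff)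
    then show ?thesis using assms by linarith
  qed
  then have "hit_ge (K + S) X = \<infinity>" by (simp add: hit_ge_eq_infinity_iff)
  then show ?thesis by simp
qed

text \<open>Telescoping of \<open>hit_time_block\<close>. The blocks start at \<open>S\<close>
  rather than 0 because the lower bound for a block needs a walk that starts strictly to the left of
  it.\<close>

lemma sum_block_time_le:
  "(\<Sum>j<k. block_time (int (Suc j) * int S) (int S) R N X) \<le> hit_time (int (Suc k) * int S) X"
proof (induction k)
  case (Suc k)
  have "(\<Sum>j<Suc k. block_time (int (Suc j) * int S) (int S) R N X) \<le>
      hit_time (int (Suc k) * int S) X + block_time (int (Suc k) * int S) (int S) R N X"
    using Suc by (simp add: add_right_mono)
  also have "\<dots> \<le> hit_time (int (Suc k) * int S + int S) X"
    by (rule hit_time_block) simp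
  also have "int (Suc k) * int S + int S = int (Suc (Suc k)) * int S"
    by (simp add: algebra_simps)
  finally show ?case .
qed simp

text \<open>At time n = B k the position exceeds n v/2 for large k, and this is at least k; the 2 in
  the hypothesis pays for replacing v by v/2.\<close>

lemma hit_time_linear:
  assumes X: "(\<lambda>n. real_of_int (X n) / real n) \<longlonglongrightarrow> v" and v: "real B * v \<ge> 2" "v > 0"
  shows "eventually (\<lambda>k. hit_time (int k) X \<le> of_nat (B * k)) sequentially"
proof -
  have B: "B > 0" using v by (intro Nat.gr0I) simp
  have "eventually (\<lambda>n. v / 2 < real_of_int (X n) / real n) sequentially"
    using v by (intro order_tendstoD(1)[OF X]) simp
  then obtain n0 where n0: "v / 2 < real_of_int (X n) / real n" if "n \<ge> n0" for n
    by (auto simp: eventually_sequentially)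
  show ?thesis unfolding eventually_sequentially
  proof (intro exI[of _ "Suc n0"] allI impI)
    fix k assume k: "Suc n0 \<le> k"
    let ?n = "B * k"
    have "k \<le> ?n" using B by simp
    then have "v / 2 < real_of_int (X ?n) / real ?n" using k by (intro n0) linarith
    then have "v / 2 * real ?n < real_of_int (X ?n)"
      using B k by (simp add: pos_less_divide_eq)
    moreover have "real k \<le> v / 2 * real ?n"
      using mult_right_mono[OF v(1), of "real k"] by (simp add: algebra_simps)
    ultimately have "X ?n \<ge> int k" by linarith
    then have "hit_ge (int k) X \<le> enat ?n"
      unfolding hit_ge_def by (intro Inf_lower) simp
    then have "hit_time (int k) X \<le> ennreal_of_enat (enat ?n)" by (simp only: ennreal_of_enat_le_iff)
    then show "hit_time (int k) X \<le> of_nat (B * k)" by (simp only: ennreal_of_enat_enat)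
  qed
qed

text \<open>Forcing the first n steps to follow \<open>p\<close> costs the product of their
  transition probabilities. These steps leave from sites below \<open>K'\<close>, so
  \<open>trunc_hit_shift\<close> compares what follows with the passage of
  \<open>K'\<close>.\<close>

lemma quenched_path_bound:
  assumes \<omega>: "\<omega> \<in> space env_space" and p: "\<And>k. k < n \<Longrightarrow> p k < K'" and le: "K \<le> K'"
  shows "(\<Prod>k<n. emeasure (\<omega> (p k)) {p (Suc k)}) * (\<integral>\<^sup>+X. trunc_hit K N X \<partial>quenched \<omega> (p n)) \<le>
    (\<integral>\<^sup>+X. trunc_hit K' N X \<partial>quenched \<omega> (p 0))"
proof -
  have "(\<Prod>k<n. emeasure (\<omega> (p k)) {p (Suc k)}) * (\<integral>\<^sup>+X. trunc_hit K N X \<partial>quenched \<omega> (p n)) =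
      (\<integral>\<^sup>+X. indicator (cylinder n p) X * trunc_hit K N (shift_path n X) \<partial>quenched \<omega> (p 0))"
    by (subst quenched_markov_cylinder[OF \<omega> measurable_trunc_hit]) (simp add: emeasure_cylinder[OF \<omega>])
  also have "\<dots> \<le> (\<integral>\<^sup>+X. trunc_hit K' N X \<partial>quenched \<omega> (p 0))"
  proof (rule nn_integral_mono)
    fix X
    show "indicator (cylinder n p) X * trunc_hit K N (shift_path n X) \<le> trunc_hit K' N X"
    proof (cases "X \<in> cylinder n p")
      case True
      then have "trunc_hit K N (shift_path n X) \<le> trunc_hit K' N X"
        using p le by (intro trunc_hit_shift) simp_all
      then show ?thesis using True by (simp del: mem_cylinder)
    qed (simp del: mem_cylinder)
  qed
  finally show ?thesis .
qed

lemma nn_integral_block_time: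
  assumes \<omega>: "\<omega> \<in> space env_space"
  shows "(\<integral>\<^sup>+X. block_time K S R N X \<partial>quenched \<omega> x) =
    (\<Sum>n. \<Sum>i<R. emeasure (quenched \<omega> x) (first_hit K n (K + int i)) *
      (\<integral>\<^sup>+X. trunc_hit (K + S) N X \<partial>quenched \<omega> (K + int i)))"
proof -
  note [measurable_cong] = sets_quenched[OF \<omega>]
  have "(\<integral>\<^sup>+X. block_time K S R N X \<partial>quenched \<omega> x) =
      (\<Sum>n. \<Sum>i<R. \<integral>\<^sup>+X. indicator (first_hit K n (K + int i)) X * trunc_hit (K + S) N (shift_path n X) \<partial>quenched \<omega> x)"
    unfolding block_time_def
    by (subst nn_integral_suminf, measurable, subst nn_integral_sum, measurable)
  also have "\<dots> = (\<Sum>n. \<Sum>i<R. emeasure (quenched \<omega> x) (first_hit K n (K + int i)) *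
      (\<integral>\<^sup>+X. trunc_hit (K + S) N X \<partial>quenched \<omega> (K + int i)))"
    by (intro suminf_cong sum.cong refl quenched_markov[OF \<omega> measurable_trunc_hit prefix_event_first_hit])
       (simp add: first_hit_iff)
  finally show ?thesis .
qed

section \<open>Dependence on the environment below a level, and the entrance points\<close>

lemma quenched_first_hit_local:
  assumes \<omega>: "\<omega> \<in> space env_space" "\<omega>' \<in> space env_space" and eq: "\<And>x. x < K \<Longrightarrow> \<omega> x = \<omega>' x"
  shows "emeasure (quenched \<omega> x) (first_hit K n z) = emeasure (quenched \<omega>' x) (first_hit K n z)"
  using eq by (intro quenched_local[OF \<omega> _ prefix_event_first_hit, of "{..<K}"]) (auto simp: first_hit_iff)

lemma quenched_trunc_hit_local:
  assumes \<omega>: "\<omega> \<in> space env_space" "\<omega>' \<in> space env_space" and eq: "\<And>x. x < K \<Longrightarrow> \<omega> x = \<omega>' x"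
  shows "(\<integral>\<^sup>+X. trunc_hit K N X \<partial>quenched \<omega> x) = (\<integral>\<^sup>+X. trunc_hit K N X \<partial>quenched \<omega>' x)"
proof -
  have sum: "(\<integral>\<^sup>+X. trunc_hit K N X \<partial>quenched \<eta> x) = (\<Sum>m<N. emeasure (quenched \<eta> x) (stay_below K m))"
    if "\<eta> \<in> space env_space" for \<eta>
  proof -
    note [measurable_cong] = sets_quenched[OF that]
    show ?thesis unfolding trunc_hit_def by (subst nn_integral_sum) simp_all
  qed
  have "emeasure (quenched \<omega> x) (stay_below K m) = emeasure (quenched \<omega>' x) (stay_below K m)" for m
    using eq by (intro quenched_local[OF \<omega>, where S="{..<K}" and n=m]) (auto simp: stay_below_def prefix_event_def)
  then show ?thesis by (simp add: sum \<omega>)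
qed

text \<open>Transience makes the walk reach \<open>[K, \<infinity>)\<close>. Since x < K, the
  entrance is made by a jump of size at most R from below \<open>K\<close>, so it lands among the
  first R sites from \<open>K\<close> on.\<close>

lemma suminf_first_hit_ge_1:
  assumes \<omega>: "\<omega> \<in> space env_space" and K: "x < K"
    and bounded: "\<And>a b. b > a + int R \<Longrightarrow> trans_prob \<omega> a b = 0"
    and tr: "AE X in quenched \<omega> x. filterlim X at_top sequentially"
  shows "1 \<le> (\<Sum>n. \<Sum>i<R. emeasure (quenched \<omega> x) (first_hit K n (K + int i)))"
proof -
  let ?Q = "quenched \<omega> x" and ?A = "\<lambda>n. \<Union>i<R. first_hit K n (K + int i)"
  interpret prob_space ?Q by (rule prob_space_quenched[OF \<omega>])
  have A: "range ?A \<subseteq> events"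
    by (auto simp: sets_quenched[OF \<omega>] intro!: sets.finite_UN sets_first_hit)
  have "AE X in ?Q. X \<in> (\<Union>n. ?A n)"
    using tr AE_quenched_start[OF \<omega>] AE_quenched_step[OF \<omega>]
  proof eventually_elim
    case (elim X)
    have "eventually (\<lambda>n. K \<le> X n) sequentially" using elim(1) by (simp add: filterlim_at_top)
    then obtain m where "K \<le> X m" by (auto simp: eventually_sequentially)
    then obtain n where "hit_ge K X = enat n" using hit_ge_eq_Least by blast
    then have n: "\<forall>i<n. X i < K" "K \<le> X n" by (auto simp: hit_ge_eq_enat_iff)
    with elim(2) K obtain n' where n': "n = Suc n'" by (cases n) auto
    have "X n \<le> X n' + int R"
      using elim(3)[rule_format, of n'] bounded[of "X n'" "X n"] n' by (intro leI notI) simp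
    moreover have "X n' < K" using n n' by simp
    ultimately have "nat (X n - K) < R" "X n = K + int (nat (X n - K))" using n by linarith+
    with n have "X \<in> ?A n" unfolding first_hit_iff UN_iff by (intro bexI[of _ "nat (X n - K)"]) auto
    then show ?case by blast
  qed
  then have "1 = emeasure ?Q (\<Union>n. ?A n)"
    using A by (intro emeasure_eq_1_AE[symmetric]) auto
  also have "emeasure ?Q (\<Union>n. ?A n) \<le> (\<Sum>n. emeasure ?Q (?A n))"
    by (rule emeasure_subadditive_countably[OF A])
  also have "\<dots> \<le> (\<Sum>n. \<Sum>i<R. emeasure ?Q (first_hit K n (K + int i)))"
    by (intro suminf_le emeasure_subadditive_finite) (auto simp: sets_quenched[OF \<omega>] sets_first_hit)
  finally show ?thesis .
qed

lemma prod_pos_ennreal: "(\<And>k. k \<in> A \<Longrightarrow> f k > 0) \<Longrightarrow> (\<Prod>k\<in>A. f k) > (0 :: ennreal)"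
  by (induction A rule: infinite_finite_induct) (simp_all add: ennreal_zero_less_mult_iff)

section \<open>The lower bound for blocks and its consequence\<close>

context iid_env
begin

text \<open>A jump of zero mean probability is almost surely impossible at all of the countably many
  sites. In one irreducible environment with this property, the increments of a path from 0 to
  \<open>d\<close> give the list.\<close>

lemma jumps_generate:
  assumes irred: "AE \<omega> in P. irreducible_walk \<omega>"
  shows "\<exists>js. set js \<subseteq> {j. mean_step j > 0} \<and> sum_list js = d"
proof (rule ccontr)
  assume neg: "\<not> ?thesis"
  have "AE \<omega> in P. mean_step j = 0 \<longrightarrow> emeasure (\<omega> x) {x + j} = 0" for x j
  proof (cases "mean_step j = 0")
    case True
    have "(\<lambda>\<omega>. emeasure (\<omega> x) {x + j}) \<in> borel_measurable P" by measurable
    from nn_integral_0_iff_AE[OF this] show ?thesis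
      using True nn_integral_step[of x j] by simp
  qed simp
  then have null: "AE \<omega> in P. \<forall>x j. mean_step j = 0 \<longrightarrow> emeasure (\<omega> x) {x + j} = 0"
    by (simp add: AE_all_countable)
  \<comment> \<open>The claim does not involve the environment, so its negation is refuted in almost
    every environment and \<open>P\<close> has mass 1.\<close>
  have "AE \<omega> in P. False"
    using irred null AE_space
  proof eventually_elim
    case (elim \<omega>)
    then have \<omega>: "\<omega> \<in> space env_space" by (simp add: space_P)
    obtain n where n: "measure (quenched \<omega> 0) {X. X n = d} > 0"
      using elim(1) unfolding irreducible_walk_def by blast
    \<comment> \<open>Almost every path starts at 0 and takes only steps of positive probability, so
      an event of positive probability contains such a path.\<close>
    have "\<exists>X. X 0 = 0 \<and> X n = d \<and> (\<forall>k. trans_prob \<omega> (X k) (X (Suc k)) > 0)"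
    proof (rule ccontr)
      assume none: "\<not> ?thesis"
      have "AE X in quenched \<omega> 0. X \<notin> {X. X n = d}"
        using AE_quenched_start[OF \<omega>] AE_quenched_step[OF \<omega>]
        by eventually_elim (use none in blast)
      moreover have "{X. X n = d} \<in> sets (quenched \<omega> 0)"
        unfolding sets_quenched[OF \<omega>]
        by (rule sets_prefix_event[of n]) (simp add: prefix_event_def)
      ultimately have "emeasure (quenched \<omega> 0) {X. X n = d} = 0"
        by (simp add: AE_iff_measurable[OF _ refl] sets_eq_imp_space_eq[OF sets_quenched[OF \<omega>]])
      with n show False by (simp add: measure_def)
    qed
    then obtain X where X: "X 0 = 0" "X n = d" "\<And>k. trans_prob \<omega> (X k) (X (Suc k)) > 0" by blast
    define js where "js = map (\<lambda>k. X (Suc k) - X k) [0..<n]"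
    have "mean_step (X (Suc k) - X k) > 0" for k
    proof (rule ccontr)
      assume "\<not> ?thesis"
      then have "mean_step (X (Suc k) - X k) = 0" by (simp add: not_less)
      with elim(2) have "emeasure (\<omega> (X k)) {X k + (X (Suc k) - X k)} = 0" by blast
      then show False using X(3)[of k] by (simp add: trans_prob_def measure_def)
    qed
    then have "set js \<subseteq> {j. mean_step j > 0}" by (auto simp: js_def)
    moreover have "sum_list js = X n - X 0" unfolding js_def by (induction n) simp_all
    ultimately show False using neg X by auto
  qed
  then show False by simp
qed

text \<open>The sites below \<open>K\<close> carry the entrance probabilities \<open>a\<close> and
  the delay \<open>h\<close>, those from \<open>K\<close> on carry the weight \<open>b\<close> of
  the detour. The mean of \<open>a\<close> times \<open>h\<close> is never split; only
  \<open>b\<close> is separated from it.\<close>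

lemma block_time_lower_bound:
  assumes K: "K > 0"
    and bounded: "AE \<omega> in P. \<forall>a b. b > a + int R \<longrightarrow> trans_prob \<omega> a b = 0"
    and tr: "AE \<omega> in P. AE X in quenched \<omega> 0. filterlim X at_top sequentially"
    and l: "l > 0" and S: "S \<ge> 0"
    and p: "\<And>i. i < R \<Longrightarrow> p i 0 = int i" "\<And>i. i < R \<Longrightarrow> p i (n i) = - l"
      "\<And>i k. i < R \<Longrightarrow> k < n i \<Longrightarrow> 0 \<le> p i k \<and> p i k < S" "\<And>i. i < R \<Longrightarrow> inj_on (p i) {..<n i}"
    and c: "\<And>i. i < R \<Longrightarrow> c \<le> (\<Prod>k<n i. mean_step (p i (Suc k) - p i k))"
  shows "c * (\<integral>\<^sup>+X. trunc_hit 1 N X \<partial>annealed P 0) \<le> (\<integral>\<^sup>+X. block_time K S R N X \<partial>annealed P 0)"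
proof -
  define a where "a m i \<omega> = emeasure (quenched \<omega> 0) (first_hit K m (K + int i))" for m i \<omega>
  \<comment> \<open>The passage of \<open>K\<close> rather than of \<open>K + S\<close>, so that
    only the environment below \<open>K\<close> enters.\<close>
  define h where "h \<omega> = (\<integral>\<^sup>+X. trunc_hit K N X \<partial>quenched \<omega> (K - l))" for \<omega>
  define b where "b i \<omega> = (\<Prod>k<n i. emeasure (\<omega> (K + p i k)) {K + p i (Suc k)})" for i \<omega>
  have a_meas [measurable]: "a m i \<in> borel_measurable env_space" for m i
    unfolding a_def by measurable
  have h_meas [measurable]: "h \<in> borel_measurable env_space"
    unfolding h_def by measurable
  have b_meas [measurable]: "b i \<in> borel_measurable env_space" for i
    unfolding b_def by (intro borel_measurable_prod_ennreal measurable_step_prob)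
  have b: "(\<integral>\<^sup>+\<omega>. b i \<omega> \<partial>P) = (\<Prod>k<n i. mean_step (p i (Suc k) - p i k))" if "i < R" for i
    using nn_integral_distinct_steps[of "\<lambda>k. K + p i k" "n i"] p(4)[OF that]
    unfolding b_def by (simp add: inj_on_def)
  have indep_ab: "(\<integral>\<^sup>+\<omega>. a m i \<omega> * h \<omega> * b i \<omega> \<partial>P) = (\<integral>\<^sup>+\<omega>. a m i \<omega> * h \<omega> \<partial>P) * (\<integral>\<^sup>+\<omega>. b i \<omega> \<partial>P)"
    if i: "i < R" for m i
  proof (rule nn_integral_indep_sites[where S="{..<K}"])
    fix \<omega> \<omega>' assume \<omega>: "\<omega> \<in> space env_space" "\<omega>' \<in> space env_space"
    show "a m i \<omega> * h \<omega> = a m i \<omega>' * h \<omega>'" if eq: "\<And>x. x \<in> {..<K} \<Longrightarrow> \<omega> x = \<omega>' x"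
      unfolding a_def h_def
      using quenched_first_hit_local[OF \<omega>, of K] quenched_trunc_hit_local[OF \<omega>, of K] eq by simp
    show "b i \<omega> = b i \<omega>'" if eq: "\<And>x. x \<notin> {..<K} \<Longrightarrow> \<omega> x = \<omega>' x"
      unfolding b_def
    proof (intro prod.cong refl)
      fix k assume "k \<in> {..<n i}"
      then have "\<not> K + p i k < K" using p(3)[OF i, of k] by simp
      then show "emeasure (\<omega> (K + p i k)) {K + p i (Suc k)} = emeasure (\<omega>' (K + p i k)) {K + p i (Suc k)}"
        using eq[of "K + p i k"] by simp
    qed
  qed measurable
  have quenched_bound: "b i \<omega> * h \<omega> \<le> (\<integral>\<^sup>+X. trunc_hit (K + S) N X \<partial>quenched \<omega> (K + int i))"
    if "\<omega> \<in> space P" "i < R" for i \<omega>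
    using quenched_path_bound[of \<omega> "n i" "\<lambda>k. K + p i k" "K + S" K N] p[OF that(2)] that S
    by (simp add: space_P b_def h_def)
  have total: "AE \<omega> in P. 1 \<le> (\<Sum>m. \<Sum>i<R. a m i \<omega>)"
    using bounded tr AE_space
  proof eventually_elim
    case (elim \<omega>)
    then show ?case
      unfolding a_def by (intro suminf_first_hit_ge_1) (simp_all add: K space_P)
  qed
  have "(\<integral>\<^sup>+X. trunc_hit 1 N X \<partial>annealed P 0) = (\<integral>\<^sup>+\<omega>. \<integral>\<^sup>+X. trunc_hit 1 N X \<partial>quenched \<omega> 0 \<partial>P)"
    by (rule nn_integral_annealed) measurable
  also have "\<dots> = (\<integral>\<^sup>+\<omega>. \<integral>\<^sup>+X. trunc_hit (1 + (K - l)) N X \<partial>quenched \<omega> (K - l) \<partial>P)"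
    using nn_integral_quenched_shift[OF measurable_trunc_hit[of 1 N], where z="K - l" and x=0]
    by (simp only: trunc_hit_translate add_0)
  \<comment> \<open>By \<open>l > 0\<close>, the level \<open>1 + (K - l)\<close> is at most
    \<open>K\<close>.\<close>
  also have "\<dots> \<le> (\<integral>\<^sup>+\<omega>. h \<omega> \<partial>P)"
    unfolding h_def using l by (intro nn_integral_mono trunc_hit_mono) simp
  also have "\<dots> \<le> (\<integral>\<^sup>+\<omega>. (\<Sum>m. \<Sum>i<R. a m i \<omega> * h \<omega>) \<partial>P)"
  proof (rule nn_integral_mono_AE)
    show "AE \<omega> in P. h \<omega> \<le> (\<Sum>m. \<Sum>i<R. a m i \<omega> * h \<omega>)"
      using total
    proof eventually_elim
      case (elim \<omega>)
      \<comment> \<open>Since \<open>h\<close> does not depend on the entrance point, it can be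
        multiplied into the whole sum.\<close>
      have "1 * h \<omega> \<le> (\<Sum>m. \<Sum>i<R. a m i \<omega>) * h \<omega>" by (intro mult_right_mono elim) simp
      then show ?case by (simp add: sum_distrib_right flip: ennreal_suminf_multc)
    qed
  qed
  also have "\<dots> = (\<Sum>m. \<Sum>i<R. \<integral>\<^sup>+\<omega>. a m i \<omega> * h \<omega> \<partial>P)"
    by (subst nn_integral_suminf, measurable, subst nn_integral_sum, measurable)
  finally have "c * (\<integral>\<^sup>+X. trunc_hit 1 N X \<partial>annealed P 0) \<le> c * (\<Sum>m. \<Sum>i<R. \<integral>\<^sup>+\<omega>. a m i \<omega> * h \<omega> \<partial>P)"
    by (rule mult_left_mono) simp
  also have "\<dots> = (\<Sum>m. \<Sum>i<R. c * (\<integral>\<^sup>+\<omega>. a m i \<omega> * h \<omega> \<partial>P))"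
    by (simp add: sum_distrib_left flip: ennreal_suminf_cmult)
  also have "\<dots> \<le> (\<Sum>m. \<Sum>i<R. \<integral>\<^sup>+\<omega>. a m i \<omega> * (\<integral>\<^sup>+X. trunc_hit (K + S) N X \<partial>quenched \<omega> (K + int i)) \<partial>P)"
  proof (intro suminf_le sum_mono)
    fix m i assume "i \<in> {..<R}"
    then have i: "i < R" by simp
    have "c * (\<integral>\<^sup>+\<omega>. a m i \<omega> * h \<omega> \<partial>P) \<le> (\<integral>\<^sup>+\<omega>. b i \<omega> \<partial>P) * (\<integral>\<^sup>+\<omega>. a m i \<omega> * h \<omega> \<partial>P)"
      using c[OF i] by (intro mult_right_mono) (simp_all add: b[OF i])
    \<comment> \<open>Independence of the two sides of \<open>K\<close> turns the product of means
      into the mean of the product: entrance, detour, delay.\<close>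
    also have "\<dots> = (\<integral>\<^sup>+\<omega>. a m i \<omega> * (b i \<omega> * h \<omega>) \<partial>P)"
      by (simp only: mult.commute[of "\<integral>\<^sup>+\<omega>. b i \<omega> \<partial>P"] flip: indep_ab[OF i])
         (simp only: mult_ac)
    also have "\<dots> \<le> (\<integral>\<^sup>+\<omega>. a m i \<omega> * (\<integral>\<^sup>+X. trunc_hit (K + S) N X \<partial>quenched \<omega> (K + int i)) \<partial>P)"
      by (intro nn_integral_mono mult_left_mono quenched_bound i) simp_all
    finally show "c * (\<integral>\<^sup>+\<omega>. a m i \<omega> * h \<omega> \<partial>P) \<le>
      (\<integral>\<^sup>+\<omega>. a m i \<omega> * (\<integral>\<^sup>+X. trunc_hit (K + S) N X \<partial>quenched \<omega> (K + int i)) \<partial>P)" .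
  qed simp_all
  also have "\<dots> = (\<integral>\<^sup>+\<omega>. (\<Sum>m. \<Sum>i<R. a m i \<omega> * (\<integral>\<^sup>+X. trunc_hit (K + S) N X \<partial>quenched \<omega> (K + int i))) \<partial>P)"
    by (subst nn_integral_suminf, measurable, subst nn_integral_sum, measurable)
  also have "\<dots> = (\<integral>\<^sup>+\<omega>. \<integral>\<^sup>+X. block_time K S R N X \<partial>quenched \<omega> 0 \<partial>P)"
    unfolding a_def by (intro nn_integral_cong nn_integral_block_time[symmetric]) (simp add: space_P)
  also have "\<dots> = (\<integral>\<^sup>+X. block_time K S R N X \<partial>annealed P 0)"
    by (rule nn_integral_annealed[symmetric]) measurable
  finally show ?thesis .
qed

text \<open>One path is chosen for each of the R entrance offsets. \<open>S\<close> exceeds every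
  site that these finitely many paths leave, and \<open>c\<close> is the smallest of their mean
  weights; neither depends on \<open>K\<close> or \<open>N\<close>.\<close>

lemma block_time_uniform_lower_bound:
  assumes R: "R > 0"
    and irred: "AE \<omega> in P. irreducible_walk \<omega>"
    and bounded: "AE \<omega> in P. \<forall>a b. b > a + int R \<longrightarrow> trans_prob \<omega> a b = 0"
    and tr: "AE \<omega> in P. AE X in quenched \<omega> 0. filterlim X at_top sequentially"
  obtains S :: nat and c :: ennreal where "S > 0" "c > 0"
    "\<And>K N. K > 0 \<Longrightarrow> c * (\<integral>\<^sup>+X. trunc_hit 1 N X \<partial>annealed P 0) \<le> (\<integral>\<^sup>+X. block_time K (int S) R N X \<partial>annealed P 0)"
proof -
  obtain l where l: "l > 0"
    and ex: "\<And>i. i \<ge> 0 \<Longrightarrow> \<exists>n p. p 0 = i \<and> p n = - l \<and>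
      (\<forall>k<n. p k \<ge> 0 \<and> p (Suc k) - p k \<in> {j. mean_step j > 0}) \<and> inj_on p {..<n}"
    using self_avoiding_exit[of "{j. mean_step j > 0}"] jumps_generate[OF irred] by blast
  have "\<forall>i. \<exists>n p. p 0 = int i \<and> p n = - l \<and>
      (\<forall>k<n. p k \<ge> 0 \<and> p (Suc k) - p k \<in> {j. mean_step j > 0}) \<and> inj_on p {..<n}"
    using ex by simp
  then obtain n p where p: "\<And>i :: nat. p i 0 = int i \<and> p i (n i) = - l \<and>
      (\<forall>k<n i. p i k \<ge> 0 \<and> p i (Suc k) - p i k \<in> {j. mean_step j > 0}) \<and> inj_on (p i) {..<n i}"
    by metis
  define V where "V = (\<Union>i<R. p i ` {..<n i})"
  have V: "finite V" by (simp add: V_def)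
  define S where "S = Suc (nat (Max (insert 0 V)))"
  have less: "p i k < int S" if "i < R" "k < n i" for i k
  proof -
    have "p i k \<le> Max (insert 0 V)" using that V by (intro Max_ge) (auto simp: V_def)
    then show ?thesis by (simp add: S_def)
  qed
  define w where "w i = (\<Prod>k<n i. mean_step (p i (Suc k) - p i k))" for i
  have w: "w i > 0" for i
    unfolding w_def using p[of i] by (intro prod_pos_ennreal) auto
  define c where "c = Min (w ` {..<R})"
  have "c > 0" unfolding c_def using w R by (subst Min_gr_iff) auto
  show thesis
  proof (rule that[of S c])
    show "c * (\<integral>\<^sup>+X. trunc_hit 1 N X \<partial>annealed P 0) \<le> (\<integral>\<^sup>+X. block_time K (int S) R N X \<partial>annealed P 0)"
      if "K > 0" for K N
    proof (rule block_time_lower_bound[OF that bounded tr l, where p=p and n=n])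
      show "c \<le> (\<Prod>k<n i. mean_step (p i (Suc k) - p i k))" if "i < R" for i
        using that unfolding c_def w_def[symmetric] by (intro Min_le) auto
    qed (use p less in auto)
  qed (use \<open>c > 0\<close> in \<open>simp_all add: S_def\<close>)
qed

lemma finite_if_speed_pos:
  assumes R: "R > 0"
    and irred: "AE \<omega> in P. irreducible_walk \<omega>"
    and bounded: "AE \<omega> in P. \<forall>a b. b > a + int R \<longrightarrow> trans_prob \<omega> a b = 0"
    and tr: "AE \<omega> in P. AE X in quenched \<omega> 0. filterlim X at_top sequentially"
    and vel: "AE X in annealed P 0. (\<lambda>n. real_of_int (X n) / real n) \<longlonglongrightarrow> v"
    and v: "v > 0"
  shows "(\<integral>\<^sup>+X. hit_time 1 X \<partial>annealed P 0) < \<infinity>"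
proof -
  interpret A: prob_space "annealed P 0" by (rule prob_space_annealed)
  obtain S c where S: "S > 0" and c: "c > 0"
    and low: "\<And>K N. K > 0 \<Longrightarrow> c * (\<integral>\<^sup>+X. trunc_hit 1 N X \<partial>annealed P 0) \<le> (\<integral>\<^sup>+X. block_time K (int S) R N X \<partial>annealed P 0)"
    using block_time_uniform_lower_bound[OF R irred bounded tr] by blast
  obtain B :: nat where B: "real B * v \<ge> 2"
    using ex_less_of_nat_mult[OF v, of 2] less_imp_le by blast
  \<comment> \<open>The first k + 1 blocks end at level (k + 2) S, reached by time B (k + 2) S for
    large k. As k + 2 \<le> 2 (k + 1), their average is at most 2 B S.\<close>
  define C where "C = B * 2 * S"
  have trunc: "c * (\<integral>\<^sup>+X. trunc_hit 1 N X \<partial>annealed P 0) \<le> of_nat C" for N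
  proof -
    let ?b = "\<lambda>j. block_time (int (Suc j) * int S) (int S) R N"
    define u where "u k X = (\<Sum>j<Suc k. ?b j X) / of_nat (Suc k)" for k X
    have [measurable]: "u k \<in> borel_measurable path_space" for k
      unfolding u_def [abs_def] by measurable
    have cancel: "of_nat (Suc k) * x / of_nat (Suc k) = x" for k and x :: ennreal
      by (subst mult.commute, subst ennreal_mult_divide_eq) (simp_all add: ennreal_of_nat_eq_real_of_nat)
    have u_le: "u k X \<le> of_nat N" for k X
    proof -
      have "u k X \<le> (\<Sum>j<Suc k. of_nat N) / of_nat (Suc k)"
        unfolding u_def by (intro divide_right_mono_ennreal sum_mono block_time_le_of_nat)
      also have "\<dots> = of_nat N" by (simp only: sum_constant card_lessThan cancel)
      finally show ?thesis .
    qed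
    have "AE X in annealed P 0. limsup (\<lambda>k. u k X) \<le> of_nat C"
      using vel
    proof eventually_elim
      case (elim X)
      obtain k0 where k0: "hit_time (int k) X \<le> of_nat (B * k)" if "k \<ge> k0" for k
        using hit_time_linear[OF elim B v] by (auto simp: eventually_sequentially)
      have "u k X \<le> of_nat C" if "k \<ge> k0" for k
      proof -
        have "Suc (Suc k) * 1 \<le> Suc (Suc k) * S" using S by (intro mult_left_mono) simp_all
        with that have "k0 \<le> Suc (Suc k) * S" by (simp only: mult_1_right)
        then have "hit_time (int (Suc (Suc k) * S)) X \<le> of_nat (B * (Suc (Suc k) * S))" by (rule k0)
        also have "B * (Suc (Suc k) * S) \<le> Suc k * C"
          by (simp add: C_def algebra_simps)
        finally have "hit_time (int (Suc (Suc k) * S)) X \<le> of_nat (Suc k) * of_nat C"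
          by (simp only: of_nat_mult[symmetric] of_nat_mono)
        then have "(\<Sum>j<Suc k. ?b j X) \<le> of_nat (Suc k) * of_nat C"
          using sum_block_time_le[where k="Suc k" and S=S and R=R and N=N and X=X]
          by (simp only: of_nat_mult order_trans)
        then have "u k X \<le> of_nat (Suc k) * of_nat C / of_nat (Suc k)"
          unfolding u_def by (rule divide_right_mono_ennreal)
        then show ?thesis by (simp only: cancel)
      qed
      then show ?case
        by (intro Limsup_bounded) (auto simp: eventually_sequentially)
    qed
    note limsup_le = this
    have "c * (\<integral>\<^sup>+X. trunc_hit 1 N X \<partial>annealed P 0) \<le> limsup (\<lambda>k. \<integral>\<^sup>+X. u k X \<partial>annealed P 0)"
    proof (rule le_Limsup)
      show "\<forall>\<^sub>F k in sequentially. c * (\<integral>\<^sup>+X. trunc_hit 1 N X \<partial>annealed P 0) \<le> (\<integral>\<^sup>+X. u k X \<partial>annealed P 0)"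
      proof (intro always_eventually allI)
        fix k
        have "of_nat (Suc k) * (c * (\<integral>\<^sup>+X. trunc_hit 1 N X \<partial>annealed P 0)) =
            (\<Sum>j<Suc k. c * (\<integral>\<^sup>+X. trunc_hit 1 N X \<partial>annealed P 0))"
          by (simp only: sum_constant card_lessThan)
        also have "\<dots> \<le> (\<Sum>j<Suc k. \<integral>\<^sup>+X. ?b j X \<partial>annealed P 0)"
          using S by (intro sum_mono low) simp
        finally have "of_nat (Suc k) * (c * (\<integral>\<^sup>+X. trunc_hit 1 N X \<partial>annealed P 0)) / of_nat (Suc k) \<le>
            (\<Sum>j<Suc k. \<integral>\<^sup>+X. ?b j X \<partial>annealed P 0) / of_nat (Suc k)"
          by (rule divide_right_mono_ennreal)
        also have "\<dots> = (\<integral>\<^sup>+X. u k X \<partial>annealed P 0)"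
          unfolding u_def by (subst nn_integral_divide, measurable, subst nn_integral_sum, measurable)
        finally show "c * (\<integral>\<^sup>+X. trunc_hit 1 N X \<partial>annealed P 0) \<le> (\<integral>\<^sup>+X. u k X \<partial>annealed P 0)"
          by (simp only: cancel)
      qed
    qed simp
    \<comment> \<open>Reverse Fatou, dominated by the constant \<open>N\<close>; this step requires
      the truncation.\<close>
    also have "\<dots> \<le> (\<integral>\<^sup>+X. limsup (\<lambda>k. u k X) \<partial>annealed P 0)"
      by (rule nn_integral_limsup[where w="\<lambda>_. of_nat N"])
         (use u_le in \<open>simp_all add: A.emeasure_space_1 measurable_cong_sets[OF sets_annealed refl] of_nat_less_top\<close>)
    also have "\<dots> \<le> (\<integral>\<^sup>+X. of_nat C \<partial>annealed P 0)"
      by (rule nn_integral_mono_AE[OF limsup_le])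
    also have "\<dots> = of_nat C" by (simp add: A.emeasure_space_1)
    finally show ?thesis .
  qed
  \<comment> \<open>The bound \<open>C\<close> does not depend on \<open>N\<close>, so monotone
    convergence removes the truncation.\<close>
  have "c * (\<integral>\<^sup>+X. hit_time 1 X \<partial>annealed P 0) = (SUP N. c * (\<integral>\<^sup>+X. trunc_hit 1 N X \<partial>annealed P 0))"
    unfolding nn_integral_hit_time_eq_SUP[OF sets_annealed] by (rule SUP_mult_left_ennreal)
  also have "\<dots> \<le> of_nat C" by (rule SUP_least) (rule trunc)
  finally have "c * (\<integral>\<^sup>+X. hit_time 1 X \<partial>annealed P 0) < \<infinity>"
    by (rule le_less_trans) (simp add: of_nat_less_top)
  then show ?thesis using c by (auto simp: ennreal_mult_less_top)
qed

end

theorem lemma1p2: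
  fixes P :: "(int \<Rightarrow> int measure) measure" and L R :: nat and v :: real
  assumes prob: "prob_space P" and sets_P: "sets P = sets env_space"
    and L_pos: "L > 0" and R_pos: "R > 0"
    and indep: "prob_space.indep_vars P (\<lambda>_. prob_algebra (count_space UNIV))
                  (\<lambda>x \<omega>. trans_vec \<omega> x) (UNIV :: int set)"
    and ident: "\<And>x y. distr P (prob_algebra (count_space UNIV)) (\<lambda>\<omega>. trans_vec \<omega> x)
                     = distr P (prob_algebra (count_space UNIV)) (\<lambda>\<omega>. trans_vec \<omega> y)"
    and irred: "AE \<omega> in P. irreducible_walk \<omega>"
    and bounded_jumps: "AE \<omega> in P. \<forall>a b. b \<notin> {a - int L .. a + int R} \<longrightarrow> trans_prob \<omega> a b = 0"
    and transient: "AE \<omega> in P. AE X in quenched \<omega> 0. filterlim X at_top sequentially"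
    and velocity: "AE X in annealed P 0. (\<lambda>n. real_of_int (X n) / real n) \<longlonglongrightarrow> v"
  shows "v > 0 \<longleftrightarrow> (\<integral>\<^sup>+ X. ennreal_of_enat (hit_ge 1 X) \<partial>(annealed P 0)) < \<infinity>"
proof -
  interpret iid_env P
    using prob sets_P indep ident by (intro iid_env.intro iid_env_axioms.intro)
  have "AE \<omega> in P. \<forall>a b. b > a + int R \<longrightarrow> trans_prob \<omega> a b = 0"
    using bounded_jumps by eventually_elim simp
  then show ?thesis
    using finite_if_speed_pos[OF R_pos irred _ transient velocity]
      speed_pos_if_finite[OF velocity transient] by blast
qed

end
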